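(* Let $N\ge 1$, $1\le k\le N$, $x\in\mathbb{Z}$, $t\ge0$, $Y=(1,2,\dots,N)$, and let $C$ be a counterclockwise circle centered at the origin with radius in $(0,1)$. Then \[ \mathbb{P}_{(Y,\nu^{(k)})}(E_{t,k,x}) = \frac{(-1)^{N(N-1)/2}}{N!}\,\frac{1}{(2\pi i)^N}\oint_C\cdots\oint_C\prod_{1\leq i<j\leq N}(\xi_j-\xi_i)^2\prod_{i=1}^N\frac{1}{(\xi_i-1)^{N-1}}\prod_{i=1}^N \Big(\xi_i^{x-N-1}e^{\varepsilon(\xi_i) t}\Big)\,d\xi_1\cdots d\xi_N . \] In particular the right side does not depend on $k$.
   Context: TASEP with second class particles: $N$ particles occupy distinct sites of $\mathbb{Z}$; each particle carries a label $1$ or $2$ (label-$2$ particles are "first class", label-$1$ particles are "second class"). Each particle independently, at rate $1$, attempts to jump to the neighboring site to its right: if that site is empty the jump occurs; if it is occupied by a particle of the same label the jump is suppressed; if a label-$2$ particle attempts to jump onto a site occupied by a label-$1$ particle, the two exchange positions; if a label-$1$ particle attempts to jump onto a site occupied by a label-$2$ particle, the jump is suppressed. A state is a pair $(X,\pi)$ with $X=(x_1<\dots<x_N)\in\mathbb{Z}^N$ and $\pi\in\{1,2\}^N$, meaning the $i$-th particle from the left is at $x_i$ and has label $\pi_i$. For $1\le k\le N$, $\nu^{(k)}$ is the sequence with first $k$ entries $2$ and remaining $N-k$ entries $1$. $E_{t,k,x}$ is the event that at time $t$ the state is $(X,\nu^{(k)})$ for some $X$ with $x_1=x,x_2=x+1,\dots,x_k=x+k-1$.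 $\mathbb{P}_{(Y,\nu)}$ is the law of the process started from state $(Y,\nu)$. $\varepsilon(\xi)=1/\xi-1$. *)

theory Defs
  imports "HOL-Probability.Probability"
begin

text \<open>States: a pair (X, pi) of the list of positions x_1 < ... < x_N (left to right)
  and the list of labels pi_i in {1,2} (2 = first class, 1 = second class).\<close>

type_synonym state = "int list \<times> nat list"

definition attempt :: "nat \<Rightarrow> state \<Rightarrow> state" where
  "attempt i s = (let X = fst s; p = snd s in
     if Suc i < length X \<and> X ! Suc i = X ! i + 1 then
       (if p ! i = 2 \<and> p ! Suc i = 1 then (X, p[i := 1, Suc i := 2]) else (X, p))
     else (X[i := X ! i + 1], p))"

text \<open>Uniformised jump chain: each particle has an independent rate-1 clock, so the
  superposition is a rate-N Poisson clock whose rings pick a uniform particle.\<close>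
definition jump_step :: "state \<Rightarrow> state pmf" where
  "jump_step s = map_pmf (\<lambda>i. attempt i s) (pmf_of_set {..<length (fst s)})"

definition jump_chain :: "nat \<Rightarrow> state \<Rightarrow> state pmf" where
  "jump_chain n s0 = ((\<lambda>q. bind_pmf q jump_step) ^^ n) (return_pmf s0)"

definition tasep_prob :: "real \<Rightarrow> state \<Rightarrow> state set \<Rightarrow> real" where
  "tasep_prob t s0 A = (let N = real (length (fst s0)) in
     (\<Sum>n. exp (- N * t) * (N * t) ^ n / fact n * measure_pmf.prob (jump_chain n s0) A))"

definition nu :: "nat \<Rightarrow> nat \<Rightarrow> nat list" where
  "nu N k = replicate k 2 @ replicate (N - k) 1"

text \<open>Event E_{t,k,x} (the time t is handled by tasep_prob).\<close>
definition E_event :: "nat \<Rightarrow> nat \<Rightarrow> int \<Rightarrow> state set" where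
  "E_event N k x = {(X, p). length X = N \<and> p = nu N k \<and> (\<forall>i<k. X ! i = x + int i)}"

definition step_init :: "nat \<Rightarrow> int list" where
  "step_init N = map int [1..<N+1]"

definition eps :: "complex \<Rightarrow> complex" where
  "eps z = 1 / z - 1"

text \<open>N-fold contour integral over the counterclockwise circle |z| = r, written out via the
  parametrisation z_j = r e^{i theta_j}, dz_j = i r e^{i theta_j} d theta_j, theta_j \<in> [0, 2 pi].\<close>
definition circle_integral_N :: "nat \<Rightarrow> real \<Rightarrow> ((nat \<Rightarrow> complex) \<Rightarrow> complex) \<Rightarrow> complex" where
  "circle_integral_N N r F =
     integral\<^sup>L (PiM {..<N} (\<lambda>_. restrict_space lborel {0..2*pi}))
       (\<lambda>\<theta>. F (\<lambda>j. of_real r * cis (\<theta> j)) * (\<Prod>j<N. \<i> * of_real r * cis (\<theta> j)))"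

definition integrand :: "nat \<Rightarrow> int \<Rightarrow> real \<Rightarrow> (nat \<Rightarrow> complex) \<Rightarrow> complex" where
  "integrand N x t \<xi> =
     (\<Prod>i<N. \<Prod>j\<in>{i<..<N}. (\<xi> j - \<xi> i) ^ 2)
     * (\<Prod>i<N. 1 / (\<xi> i - 1) ^ (N - 1))
     * (\<Prod>i<N. \<xi> i powi (x - int N - 1) * exp (eps (\<xi> i) * of_real t))"

end

(* For labels nu^(k), a state whose label sequence has left nu^(k) never returns to it, so the
   probability of E_{t,k,x} as a function of the initial positions Y solves a backward equation in
   which the pair (k, k+1) is annihilated on collision and all other neighbouring pairs exclude each
   other.  With row functions h_i(y, z) = z^(-y) (1-z)^(e_i), where e_i = i for i <= k and e_i = i - 1
   for i > k, the integrals over the torus of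
     (sum_j 1/z_j)^n det[h_i(y_i, z_j)] prod_j z_j^(x+j-1) (1-z_j)^(-j)   (against prod_j dz_j/(2 pi i z_j))
   solve the equation of the uniformised chain pointwise in z: multiplication by 1/z shifts y, equal
   exponents give equal rows (annihilation), and exponents differing by 1 give a row operation
   (exclusion).  At n = 0 the integral factorises into a determinant of Taylor coefficients which
   is either block triangular with unit diagonal or has a zero row or column, according to E.  Summing over n gives the exponential; for step
   initial positions both determinants become Vandermonde determinants, in 1/z - 1 and in z/(1-z). *)
theory Submission
  imports Defs "HOL-Complex_Analysis.Complex_Analysis" "Jordan_Normal_Form.Determinant"
begin

subsection \<open>Determinants\<close>

text \<open>Taking the entries as a function keeps row updates, column scalings and entrywise
  integrals plain lambda terms.\<close>

definition fdet :: "nat \<Rightarrow> (nat \<Rightarrow> nat \<Rightarrow> 'a::comm_ring_1) \<Rightarrow> 'a" where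
  "fdet n M = Determinant.det (mat n n (\<lambda>(i, j). M i j))"

lemma fdet_rows: "fdet n M = (\<Sum>p | p permutes {..<n}. signof p * (\<Prod>i<n. M i (p i)))"
proof -
  have "fdet n M = (\<Sum>p | p permutes {0..<n}. signof p *
      (\<Prod>i = 0..<n. mat n n (\<lambda>(i, j). M i j) $$ (i, p i)))"
    unfolding fdet_def by (rule det_def') simp
  also have "\<dots> = (\<Sum>p | p permutes {0..<n}. signof p * (\<Prod>i = 0..<n. M i (p i)))"
  proof (intro sum.cong refl arg_cong2[where f = "(*)"] prod.cong)
    fix p i assume "p \<in> {p. p permutes {0..<n}}" "i \<in> {0..<n}"
    moreover from this have "p i \<in> {0..<n}"
      using permutes_in_image[of p "{0..<n}" i] by blast
    ultimately show "mat n n (\<lambda>(i, j). M i j) $$ (i, p i) = M i (p i)"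
      by simp
  qed
  finally show ?thesis by (simp only: atLeast0LessThan)
qed

lemma fdet_transpose: "fdet n (\<lambda>i j. M j i) = fdet n M"
proof -
  have "mat n n (\<lambda>(i, j). M j i) = transpose_mat (mat n n (\<lambda>(i, j). M i j))"
    by (rule eq_matI) auto
  then show ?thesis
    unfolding fdet_def using det_transpose[of "mat n n (\<lambda>(i, j). M i j)" n] by simp
qed

lemma fdet_cols: "fdet n M = (\<Sum>p | p permutes {..<n}. signof p * (\<Prod>j<n. M (p j) j))"
  using fdet_rows[of n "\<lambda>i j. M j i"] unfolding fdet_transpose[of n M] .

lemma fdet_cong:
  assumes "\<And>i j. i < n \<Longrightarrow> j < n \<Longrightarrow> M i j = M' i j"
  shows "fdet n M = fdet n M'"
proof -
  have "mat n n (\<lambda>(i, j). M i j) = mat n n (\<lambda>(i, j). M' i j)"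
    by (rule eq_matI) (auto simp: assms)
  then show ?thesis by (simp add: fdet_def)
qed

lemma fdet_scale_cols: "fdet n (\<lambda>i j. M i j * c j) = fdet n M * (\<Prod>j<n. c j)"
  by (simp add: fdet_cols prod.distrib sum_distrib_right mult.assoc)

lemma fdet_addrow:
  assumes "k < n" "l < n" "k \<noteq> l"
  shows "fdet n (\<lambda>i j. if i = k then M k j + a * M l j else M i j) = fdet n M"
proof -
  have "mat n n (\<lambda>(i, j). if i = k then M k j + a * M l j else M i j)
      = addrow a k l (mat n n (\<lambda>(i, j). M i j))"
    by (rule eq_matI) (use assms in \<open>auto simp: add.commute\<close>)
  then show ?thesis
    unfolding fdet_def
    using det_addrow[of l n k "mat n n (\<lambda>(i, j). M i j)" a] assms by simp
qed

lemma fdet_equal_rows: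
  assumes "k < n" "l < n" "k \<noteq> l" "\<And>j. j < n \<Longrightarrow> M k j = M l j"
  shows "fdet n M = 0"
  unfolding fdet_def
proof (rule det_identical_rows)
  show "row (mat n n (\<lambda>(i, j). M i j)) k = row (mat n n (\<lambda>(i, j). M i j)) l"
    by (rule eq_vecI) (simp_all add: assms)
qed (use assms in simp_all)

text \<open>The row operations run from the bottom upwards, so each row receives its predecessor
  while that one is still unmodified.\<close>

lemma fdet_add_prev_rows:
  assumes "1 \<le> k"
  shows "fdet n (\<lambda>i j. M i j + (if k \<le> i then c * M (i - 1) j else 0)) = fdet n M"
  using assms
proof (induction "n - k" arbitrary: k)
  case 0
  then show ?case by (intro fdet_cong) auto
next
  case (Suc m)
  let ?M = "\<lambda>i j. M i j + (if Suc k \<le> i then c * M (i - 1) j else 0)"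
  have "fdet n (\<lambda>i j. M i j + (if k \<le> i then c * M (i - 1) j else 0))
      = fdet n (\<lambda>i j. if i = k then ?M k j + c * ?M (k - 1) j else ?M i j)"
    by (intro fdet_cong) auto
  also have "\<dots> = fdet n ?M"
    using Suc.prems Suc.hyps(2) by (intro fdet_addrow) auto
  also have "\<dots> = fdet n M"
    using Suc.hyps(1)[of "Suc k"] Suc.hyps(2) Suc.prems by simp
  finally show ?case .
qed

section \<open>Products over pairs and the Vandermonde determinant\<close>

lemma prod_pairs_Suc:
  fixes f :: "nat \<Rightarrow> nat \<Rightarrow> 'a::comm_monoid_mult"
  shows "(\<Prod>i<Suc n. \<Prod>j\<in>{i<..<Suc n}. f i j) = (\<Prod>i<n. \<Prod>j\<in>{i<..<n}. f i j) * (\<Prod>i<n. f i n)"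
proof -
  have "(\<Prod>i<Suc n. \<Prod>j\<in>{i<..<Suc n}. f i j) = (\<Prod>i<n. \<Prod>j\<in>{i<..<Suc n}. f i j)"
  proof -
    have "{n<..<Suc n} = {}" by auto
    then show ?thesis by simp
  qed
  also have "\<dots> = (\<Prod>i<n. (\<Prod>j\<in>{i<..<n}. f i j) * f i n)"
  proof (intro prod.cong refl)
    fix i assume "i \<in> {..<n}"
    then have "{i<..<Suc n} = insert n {i<..<n}" by auto
    then show "(\<Prod>j\<in>{i<..<Suc n}. f i j) = (\<Prod>j\<in>{i<..<n}. f i j) * f i n"
      by (simp add: mult.commute)
  qed
  finally show ?thesis by (simp add: prod.distrib)
qed

lemma prod_pairs_mult:
  fixes a :: "nat \<Rightarrow> 'a::comm_monoid_mult"
  shows "(\<Prod>i<n. \<Prod>j\<in>{i<..<n}. a i * a j) = (\<Prod>i<n. a i ^ (n - 1))"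
proof (induction n)
  case (Suc n)
  have "(\<Prod>i<n. a i ^ (n - 1)) * (\<Prod>i<n. a i) = (\<Prod>i<n. a i ^ n)"
    unfolding prod.distrib[symmetric]
    by (intro prod.cong refl) (metis lessThan_iff not_less_zero power_minus_mult zero_less_iff_neq_zero)
  with Suc show ?case
    unfolding prod_pairs_Suc by (simp add: prod.distrib mult.assoc[symmetric])
qed simp

lemma prod_pairs_const:
  fixes c :: "'a::comm_monoid_mult"
  shows "(\<Prod>i<n. \<Prod>j\<in>{i<..<n}. c) = c ^ (n * (n - 1) div 2)"
proof (induction n)
  case (Suc n)
  have "n * (n - 1) div 2 + n = Suc n * (Suc n - 1) div 2"
    by (cases n) (auto simp: algebra_simps)
  with Suc show ?case
    unfolding prod_pairs_Suc by (simp add: power_add[symmetric])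
qed simp

text \<open>Subtracting \<open>x n\<close> times the previous row from every row but the first
  clears the last column below its top entry 1. Laplace expansion along it leaves the Vandermonde
  matrix of size \<open>n\<close> with column \<open>j\<close> scaled by
  \<open>x j - x n\<close>.\<close>

lemma vandermonde:
  fixes x :: "nat \<Rightarrow> 'a::comm_ring_1"
  shows "fdet n (\<lambda>i j. x j ^ i) = (\<Prod>i<n. \<Prod>j\<in>{i<..<n}. x j - x i)"
proof (induction n)
  case 0
  then show ?case by (simp add: fdet_def)
next
  case (Suc n)
  define R where "R i j = x j ^ i + (if 1 \<le> i then - x n * x j ^ (i - 1) else 0)" for i j
  have R_Suc: "R (Suc i) j = x j ^ i * (x j - x n)" for i j
    by (simp add: R_def algebra_simps)
  define A where "A = mat (Suc n) (Suc n) (\<lambda>(i, j). R i j)"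
  have A: "A \<in> carrier_mat (Suc n) (Suc n)"
    by (simp add: A_def)
  have "fdet (Suc n) (\<lambda>i j. x j ^ i) = Determinant.det A"
    using fdet_add_prev_rows[of 1 "Suc n" "\<lambda>i j. x j ^ i" "- x n"]
    by (simp add: fdet_def R_def A_def)
  also have "\<dots> = (\<Sum>i<Suc n. A $$ (i, n) * cofactor A i n)"
    by (rule laplace_expansion_column[OF A]) simp
  also have "\<dots> = A $$ (0, n) * cofactor A 0 n"
    by (subst sum.lessThan_Suc_shift) (simp add: A_def R_Suc)
  also have "\<dots> = (-1) ^ n * Determinant.det (mat_delete A 0 n)"
    by (simp add: A_def R_def cofactor_def)
  also have "mat_delete A 0 n = mat n n (\<lambda>(i, j). x j ^ i * (x j - x n))"
    by (rule eq_matI) (auto simp: A_def mat_delete_def R_Suc)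
  also have "Determinant.det \<dots> = (\<Prod>i<n. \<Prod>j\<in>{i<..<n}. x j - x i) * (\<Prod>j<n. x j - x n)"
    using fdet_scale_cols[of n "\<lambda>i j. x j ^ i" "\<lambda>j. x j - x n"] Suc by (simp add: fdet_def)
  \<comment> \<open>The cofactor sign is spread over the \<open>n\<close> factors, turning
    \<open>x j - x n\<close> into \<open>x n - x j\<close>.\<close>
  also have "(-1) ^ n * ((\<Prod>i<n. \<Prod>j\<in>{i<..<n}. x j - x i) * (\<Prod>j<n. x j - x n))
      = (\<Prod>i<n. \<Prod>j\<in>{i<..<n}. x j - x i) * (\<Prod>j<n. - 1 * (x j - x n))"
    by (subst prod.distrib) (simp add: mult_ac)
  finally show ?case
    unfolding prod_pairs_Suc by simp
qed

section \<open>Determinants decided by their pattern of zeros\<close>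

lemma permutes_le_ge_eq_id:
  fixes n k :: nat
  assumes p: "p permutes {..<n}"
    and le: "\<And>i. i < k \<Longrightarrow> i < n \<Longrightarrow> p i \<le> i" and ge: "\<And>i. k \<le> i \<Longrightarrow> i < n \<Longrightarrow> i \<le> p i"
  shows "p = id"
proof (rule permutes_natset_ge[OF p], rule ballI)
  have fixp: "p i = i" if "i < k" "i < n" for i
    using that
  proof (induction i rule: less_induct)
    case (less i)
    show ?case
    proof (rule ccontr)
      assume "p i \<noteq> i"
      \<comment> \<open>If \<open>p i < i\<close>, the induction hypothesis fixes
        \<open>p i\<close>, so \<open>i\<close> and \<open>p i\<close> would share an image, against
        injectivity.\<close>
      with le[of i] less.prems have *: "p i < i" by force
      with less have "p (p i) = p i" by simp
      then have "p i = i" using permutes_inj[OF p] by (simp add: inj_eq)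
      with * show False by simp
    qed
  qed
  show "i \<le> p i" if "i \<in> {..<n}" for i
    using fixp[of i] ge[of i] that by (cases "i < k") auto
qed

text \<open>A nonzero Leibniz term needs \<open>p i \<le> i\<close> for \<open>i < k\<close> and
  \<open>i \<le> p i\<close> for the other rows, and only the identity satisfies both.\<close>

lemma fdet_block_triangular:
  assumes "\<And>i j. i < k \<Longrightarrow> i < j \<Longrightarrow> j < n \<Longrightarrow> M i j = 0"
    and "\<And>i j. k \<le> i \<Longrightarrow> i < n \<Longrightarrow> j < i \<Longrightarrow> M i j = 0"
    and "\<And>i. i < n \<Longrightarrow> M i i = 1"
  shows "fdet n M = 1"
proof -
  have "fdet n M = (\<Sum>p\<in>{id}. signof p * (\<Prod>i<n. M i (p i)))"
    unfolding fdet_rows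
  proof (intro sum.mono_neutral_right ballI)
    fix p assume "p \<in> {p. p permutes {..<n}} - {id}"
    then have p: "p permutes {..<n}" and "p \<noteq> id" by auto
    have p_less: "p i < n" if "i < n" for i
      using permutes_in_image[OF p, of i] that by simp
    from \<open>p \<noteq> id\<close> permutes_le_ge_eq_id[OF p, of k] obtain i where
      "i < n" "i < k \<and> i < p i \<or> k \<le> i \<and> p i < i"
      by (meson not_le)
    then have "M i (p i) = 0"
      using assms(1)[of i "p i"] assms(2)[of i "p i"] p_less[of i] by auto
    with \<open>i < n\<close> have "(\<Prod>i<n. M i (p i)) = 0"
      by (intro prod_zero) auto
    then show "signof p * (\<Prod>i<n. M i (p i)) = 0" by simp
  qed (auto simp: finite_permutations permutes_id)
  then show ?thesis using assms(3) by (simp add: sign_id)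
qed

lemma fdet_zero_col:
  assumes "j < n" "\<And>i. i < n \<Longrightarrow> M i j = 0"
  shows "fdet n M = 0"
  unfolding fdet_cols
proof (intro sum.neutral ballI)
  fix p assume "p \<in> {p. p permutes {..<n}}"
  then have "p j < n" using assms(1) permutes_in_image[of p "{..<n}" j] by simp
  then have "(\<Prod>j<n. M (p j) j) = 0"
    using assms by (intro prod_zero) auto
  then show "signof p * (\<Prod>j<n. M (p j) j) = 0" by simp
qed

lemma fdet_zero_row:
  assumes "i < n" "\<And>j. j < n \<Longrightarrow> M i j = 0"
  shows "fdet n M = 0"
  using fdet_zero_col[of i n "\<lambda>i j. M j i"] assms unfolding fdet_transpose[of n M] by simp

section \<open>Permuted columns, scaled rows and integrals of determinants\<close>

lemma fdet_permute_cols: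
  assumes p: "p permutes {..<n}"
  shows "fdet n (\<lambda>i j. M i (p j)) = signof p * fdet n M"
proof -
  have p': "p permutes {0..<n}" using p by (simp only: atLeast0LessThan)
  have lt: "p i < n" if "i < n" for i
    using permutes_in_image[OF p, of i] that by simp
  have "mat n n (\<lambda>(i, j). M j (p i))
      = mat n n (\<lambda>(i, j). mat n n (\<lambda>(i, j). M j i) $$ (p i, j))"
    by (rule eq_matI) (auto simp: lt)
  then have "fdet n (\<lambda>i j. M j (p i)) = signof p * fdet n (\<lambda>i j. M j i)"
    unfolding fdet_def using det_permute_rows[OF _ p', of "mat n n (\<lambda>(i, j). M j i)"] by simp
  then show ?thesis
    unfolding fdet_transpose[of n M] fdet_transpose[of n "\<lambda>i j. M i (p j)"] .
qed

text \<open>In the Leibniz term of \<open>p\<close>, scaling row \<open>k\<close> inserts the factor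
  \<open>c (p k)\<close>, and summed over \<open>k\<close> these factors give the same total for
  every \<open>p\<close>. With \<open>c j = 1 / \<xi> j\<close> this turns multiplication by a
  symmetric sum into a sum of single-particle shifts.\<close>

lemma sum_fdet_scale_row:
  "(\<Sum>k<n. fdet n (\<lambda>i j. if i = k then M i j * c j else M i j)) = (\<Sum>j<n. c j) * fdet n M"
proof -
  have "(\<Sum>k<n. fdet n (\<lambda>i j. if i = k then M i j * c j else M i j))
      = (\<Sum>p | p permutes {..<n}. \<Sum>k<n. signof p * (\<Prod>i<n. if i = k then M i (p i) * c (p i) else M i (p i)))"
    unfolding fdet_rows by (rule sum.swap)
  also have "\<dots> = (\<Sum>p | p permutes {..<n}. (\<Sum>j<n. c j) * (signof p * (\<Prod>i<n. M i (p i))))"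
  proof (intro sum.cong refl)
    fix p assume "p \<in> {p. p permutes {..<n}}"
    then have p: "p permutes {..<n}" by simp
    have "(\<Prod>i<n. if i = k then M i (p i) * c (p i) else M i (p i)) = c (p k) * (\<Prod>i<n. M i (p i))"
      if "k < n" for k
    proof -
      have "(\<Prod>i<n. if i = k then M i (p i) * c (p i) else M i (p i))
          = (\<Prod>i<n. (if i = k then c (p i) else 1) * M i (p i))"
        by (intro prod.cong) (auto simp: mult.commute)
      then show ?thesis using that by (simp add: prod.distrib prod.delta)
    qed
    then have "(\<Sum>k<n. signof p * (\<Prod>i<n. if i = k then M i (p i) * c (p i) else M i (p i)))
        = (\<Sum>k<n. c (p k) * (signof p * (\<Prod>i<n. M i (p i))))"
      by (intro sum.cong) (auto simp: algebra_simps)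
    also have "\<dots> = (\<Sum>k<n. c (p k)) * (signof p * (\<Prod>i<n. M i (p i)))"
      by (simp only: sum_distrib_right)
    also have "(\<Sum>k<n. c (p k)) = (\<Sum>j<n. c j)"
      using sum.permute[OF p, of c] by (simp add: comp_def)
    finally show "(\<Sum>k<n. signof p * (\<Prod>i<n. if i = k then M i (p i) * c (p i) else M i (p i)))
        = (\<Sum>j<n. c j) * (signof p * (\<Prod>i<n. M i (p i)))" .
  qed
  finally show ?thesis by (simp add: fdet_rows sum_distrib_left)
qed

text \<open>Expanded along columns, each Leibniz term is a product of functions of the separate
  variables \<open>x j\<close>, so Fubini's theorem applies term by term.\<close>

lemma
  fixes \<mu> :: "'x measure" and a b :: "nat \<Rightarrow> 'x \<Rightarrow> complex"
  assumes "sigma_finite_measure \<mu>"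
    and int: "\<And>i j. i < n \<Longrightarrow> j < n \<Longrightarrow> integrable \<mu> (\<lambda>x. a i x * b j x)"
  shows integral_fdet_prod:
      "(\<integral>x. fdet n (\<lambda>i j. a i (x j)) * (\<Prod>j<n. b j (x j)) \<partial>PiM {..<n} (\<lambda>_. \<mu>))
        = fdet n (\<lambda>i j. \<integral>x. a i x * b j x \<partial>\<mu>)"
    and integrable_fdet_prod:
      "integrable (PiM {..<n} (\<lambda>_. \<mu>)) (\<lambda>x. fdet n (\<lambda>i j. a i (x j)) * (\<Prod>j<n. b j (x j)))"
proof -
  interpret product_sigma_finite "\<lambda>_::nat. \<mu>"
    by (rule product_sigma_finite.intro) (rule assms(1))
  have eq: "fdet n (\<lambda>i j. a i (x j)) * (\<Prod>j<n. b j (x j))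
      = (\<Sum>p | p permutes {..<n}. signof p * (\<Prod>j<n. a (p j) (x j) * b j (x j)))" for x
    by (simp add: fdet_cols sum_distrib_right prod.distrib mult.assoc)
  have int': "integrable \<mu> (\<lambda>x. a (p j) x * b j x)" if "p permutes {..<n}" "j \<in> {..<n}" for p j
    using int[of "p j" j] permutes_in_image[OF that(1), of j] that(2) by simp
  have I: "integrable (PiM {..<n} (\<lambda>_. \<mu>)) (\<lambda>x. \<Prod>j<n. a (p j) (x j) * b j (x j))"
    if "p permutes {..<n}" for p
    by (rule product_integrable_prod[where f = "\<lambda>j x. a (p j) x * b j x"])
      (use int'[OF that] in auto)
  then show "integrable (PiM {..<n} (\<lambda>_. \<mu>)) (\<lambda>x. fdet n (\<lambda>i j. a i (x j)) * (\<Prod>j<n. b j (x j)))"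
    unfolding eq by (intro Bochner_Integration.integrable_sum integrable_mult_right) auto
  have "(\<integral>x. (\<Prod>j<n. a (p j) (x j) * b j (x j)) \<partial>PiM {..<n} (\<lambda>_. \<mu>))
      = (\<Prod>j<n. \<integral>x. a (p j) x * b j x \<partial>\<mu>)" if "p permutes {..<n}" for p
    by (rule product_integral_prod[where f = "\<lambda>j x. a (p j) x * b j x"])
      (use int'[OF that] in auto)
  then show "(\<integral>x. fdet n (\<lambda>i j. a i (x j)) * (\<Prod>j<n. b j (x j)) \<partial>PiM {..<n} (\<lambda>_. \<mu>))
        = fdet n (\<lambda>i j. \<integral>x. a i x * b j x \<partial>\<mu>)"
    unfolding eq fdet_cols[of n "\<lambda>i j. \<integral>x. a i x * b j x \<partial>\<mu>"]
    by (subst Bochner_Integration.integral_sum) (auto intro!: I integrable_mult_right)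
qed

text \<open>Only the second determinant is expanded. Permuting the \<open>b\<close> permutes the
  columns of the integrated matrix, and the resulting sign cancels the Leibniz sign, so all
  \<open>n!\<close> terms agree.\<close>

lemma andreief:
  fixes \<mu> :: "'x measure" and a b :: "nat \<Rightarrow> 'x \<Rightarrow> complex"
  assumes \<mu>: "sigma_finite_measure \<mu>"
    and int: "\<And>i j. i < n \<Longrightarrow> j < n \<Longrightarrow> integrable \<mu> (\<lambda>x. a i x * b j x)"
  shows "(\<integral>x. fdet n (\<lambda>i j. a i (x j)) * fdet n (\<lambda>i j. b i (x j)) \<partial>PiM {..<n} (\<lambda>_. \<mu>))
      = fact n * fdet n (\<lambda>i j. \<integral>x. a i x * b j x \<partial>\<mu>)" (is "?L = fact n * ?D")
proof -
  have int': "integrable \<mu> (\<lambda>x. a i x * b (p j) x)"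
    if "p permutes {..<n}" "i < n" "j < n" for p i j
    using int[of i "p j"] permutes_in_image[OF that(1), of j] that by simp
  have "?L = (\<integral>x. (\<Sum>p | p permutes {..<n}. signof p *
      (fdet n (\<lambda>i j. a i (x j)) * (\<Prod>j<n. b (p j) (x j)))) \<partial>PiM {..<n} (\<lambda>_. \<mu>))"
    by (rule Bochner_Integration.integral_cong)
      (simp_all add: fdet_cols[of n "\<lambda>i j. b i (x j)" for x] sum_distrib_left mult_ac)
  also have "\<dots> = (\<Sum>p | p permutes {..<n}. signof p *
      (\<integral>x. fdet n (\<lambda>i j. a i (x j)) * (\<Prod>j<n. b (p j) (x j)) \<partial>PiM {..<n} (\<lambda>_. \<mu>)))"
  proof (subst Bochner_Integration.integral_sum)
    fix p assume "p \<in> {p. p permutes {..<n}}"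
    then have p: "p permutes {..<n}" by simp
    show "integrable (PiM {..<n} (\<lambda>_. \<mu>))
        (\<lambda>x. signof p * (fdet n (\<lambda>i j. a i (x j)) * (\<Prod>j<n. b (p j) (x j))))"
      by (intro integrable_mult_right integrable_fdet_prod[OF \<mu>] int'[OF p])
  qed simp
  also have "\<dots> = (\<Sum>p | p permutes {..<n}. signof p *
      fdet n (\<lambda>i j. \<integral>x. a i x * b (p j) x \<partial>\<mu>))"
  proof (intro sum.cong refl arg_cong2[where f = "(*)"])
    fix p assume "p \<in> {p. p permutes {..<n}}"
    then show "(\<integral>x. fdet n (\<lambda>i j. a i (x j)) * (\<Prod>j<n. b (p j) (x j)) \<partial>PiM {..<n} (\<lambda>_. \<mu>))
        = fdet n (\<lambda>i j. \<integral>x. a i x * b (p j) x \<partial>\<mu>)"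
      by (intro integral_fdet_prod[OF \<mu>] int') auto
  qed
  also have "\<dots> = (\<Sum>p | p permutes {..<n}. ?D)"
  proof (intro sum.cong refl)
    fix p assume "p \<in> {p. p permutes {..<n}}"
    then show "signof p * fdet n (\<lambda>i j. \<integral>x. a i x * b (p j) x \<partial>\<mu>) = ?D"
      by (simp add: fdet_permute_cols[of p n "\<lambda>i j. \<integral>x. a i x * b j x \<partial>\<mu>"] sign_def)
  qed
  also have "\<dots> = fact n * ?D"
    by (simp add: card_permutations[of "{..<n}" n])
  finally show ?thesis .
qed

subsection \<open>Integrals over circles and tori\<close>

text \<open>Unlike integrability, this property is closed under products; over a finite measure it
  implies integrability.\<close>

definition bdd_measurable :: "'a measure \<Rightarrow> ('a \<Rightarrow> complex) \<Rightarrow> bool" where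
  "bdd_measurable M f \<longleftrightarrow> f \<in> borel_measurable M \<and> (\<exists>B. \<forall>x\<in>space M. norm (f x) \<le> B)"

lemma bdd_measurable_const: "bdd_measurable M (\<lambda>_. c)"
  by (auto simp: bdd_measurable_def)

lemma bdd_measurable_add:
  assumes "bdd_measurable M f" "bdd_measurable M g"
  shows "bdd_measurable M (\<lambda>x. f x + g x)"
proof -
  obtain B C where "\<And>x. x \<in> space M \<Longrightarrow> norm (f x) \<le> B" "\<And>x. x \<in> space M \<Longrightarrow> norm (g x) \<le> C"
    using assms unfolding bdd_measurable_def by blast
  then have "norm (f x + g x) \<le> B + C" if "x \<in> space M" for x
    using that by (intro norm_triangle_le add_mono) auto
  with assms show ?thesis
    unfolding bdd_measurable_def by (auto intro!: borel_measurable_add)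
qed

lemma bdd_measurable_mult:
  assumes "bdd_measurable M f" "bdd_measurable M g"
  shows "bdd_measurable M (\<lambda>x. f x * g x)"
proof -
  obtain B C where "\<And>x. x \<in> space M \<Longrightarrow> norm (f x) \<le> B" "\<And>x. x \<in> space M \<Longrightarrow> norm (g x) \<le> C"
    using assms unfolding bdd_measurable_def by blast
  then have "norm (f x * g x) \<le> \<bar>B\<bar> * \<bar>C\<bar>" if "x \<in> space M" for x
    using that unfolding norm_mult by (intro mult_mono) fastforce+
  with assms show ?thesis
    unfolding bdd_measurable_def by (auto intro!: borel_measurable_times)
qed

lemma bdd_measurable_sum:
  "(\<And>i. i \<in> I \<Longrightarrow> bdd_measurable M (f i)) \<Longrightarrow> bdd_measurable M (\<lambda>x. \<Sum>i\<in>I. f i x)"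
  by (induction I rule: infinite_finite_induct) (auto intro: bdd_measurable_const bdd_measurable_add)

lemma bdd_measurable_prod:
  "(\<And>i. i \<in> I \<Longrightarrow> bdd_measurable M (f i)) \<Longrightarrow> bdd_measurable M (\<lambda>x. \<Prod>i\<in>I. f i x)"
  by (induction I rule: infinite_finite_induct) (auto intro: bdd_measurable_const bdd_measurable_mult)

lemma bdd_measurable_power:
  "bdd_measurable M f \<Longrightarrow> bdd_measurable M (\<lambda>x. f x ^ n)"
  by (induction n) (auto intro: bdd_measurable_const bdd_measurable_mult)

lemma bdd_measurable_fdet:
  "(\<And>i j. i < n \<Longrightarrow> j < n \<Longrightarrow> bdd_measurable M (f i j)) \<Longrightarrow> bdd_measurable M (\<lambda>x. fdet n (\<lambda>i j. f i j x))"
  unfolding fdet_cols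
proof (intro bdd_measurable_sum bdd_measurable_mult bdd_measurable_const bdd_measurable_prod)
  fix p j assume "p \<in> {p. p permutes {..<n}}" "j \<in> {..<n}"
    and f: "\<And>i j. i < n \<Longrightarrow> j < n \<Longrightarrow> bdd_measurable M (f i j)"
  then show "bdd_measurable M (f (p j) j)"
    using permutes_in_image[of p "{..<n}" j] by simp
qed

lemma (in finite_measure) integrable_bdd_measurable:
  assumes "bdd_measurable M f"
  shows "integrable M f"
  using assms integrable_const_bound unfolding bdd_measurable_def by blast

text \<open>Bounds on \<open>S\<close> and \<open>F\<close> dominate the terms by the summable
  \<open>B ^ n / fact n * \<bar>C\<bar>\<close>, so sum and integral may be exchanged.\<close>

lemma (in finite_measure) sums_integral_exp:
  assumes S: "bdd_measurable M S" and F: "bdd_measurable M F"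
  shows "(\<lambda>n. \<integral>x. S x ^ n / fact n * F x \<partial>M) sums (\<integral>x. exp (S x) * F x \<partial>M)"
proof -
  obtain B C where B: "\<And>x. x \<in> space M \<Longrightarrow> norm (S x) \<le> B"
    and C: "\<And>x. x \<in> space M \<Longrightarrow> norm (F x) \<le> C"
    using S F unfolding bdd_measurable_def by blast
  have bd: "bdd_measurable M (\<lambda>x. S x ^ n / fact n * F x)" for n
    using S F by (auto simp: divide_inverse intro!: bdd_measurable_mult bdd_measurable_power bdd_measurable_const)
  have sm: "(\<lambda>n. S x ^ n / fact n * F x) sums (exp (S x) * F x)" for x
    using sums_mult2[OF exp_converges[of "S x"], of "F x"]
    by (simp add: scaleR_conv_of_real divide_inverse mult.commute)
  have le: "norm (S x ^ n / fact n * F x) \<le> B ^ n / fact n * \<bar>C\<bar>" if "x \<in> space M" for x n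
    unfolding norm_mult norm_divide norm_power norm_fact
    using B[OF that] C[OF that] order_trans[OF norm_ge_zero B[OF that]]
    by (intro mult_mono divide_right_mono power_mono) auto
  have B_sm: "summable (\<lambda>n. B ^ n / fact n * c)" for c
    using summable_mult2[OF summable_exp[of B], of c] by (simp add: divide_inverse mult.commute)
  have "(\<lambda>n. \<integral>x. S x ^ n / fact n * F x \<partial>M) sums (\<integral>x. (\<Sum>n. S x ^ n / fact n * F x) \<partial>M)"
  proof (rule sums_integral)
    show "integrable M (\<lambda>x. S x ^ n / fact n * F x)" for n
      by (rule integrable_bdd_measurable[OF bd])
    show "AE x in M. summable (\<lambda>n. norm (S x ^ n / fact n * F x))"
    proof (rule AE_I2)
      fix x assume "x \<in> space M"
      show "summable (\<lambda>n. norm (S x ^ n / fact n * F x))"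
        by (rule summable_comparison_test'[OF B_sm, of 0]) (use le[OF \<open>x \<in> space M\<close>] in simp)
    qed
    show "summable (\<lambda>n. \<integral>x. norm (S x ^ n / fact n * F x) \<partial>M)"
    proof (rule summable_comparison_test'[OF B_sm, of 0])
      fix n :: nat
      have "(\<integral>x. norm (S x ^ n / fact n * F x) \<partial>M) \<le> (\<integral>x. B ^ n / fact n * \<bar>C\<bar> \<partial>M)"
        by (intro integral_mono integrable_norm integrable_bdd_measurable[OF bd] integrable_const le)
      then show "norm (\<integral>x. norm (S x ^ n / fact n * F x) \<partial>M) \<le> B ^ n / fact n * (\<bar>C\<bar> * measure M (space M))"
        by (simp add: mult_ac)
    qed
  qed
  then show ?thesis unfolding sums_unique[OF sm, symmetric] .
qed

section \<open>Finite measures and mean values on circles and tori\<close>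

abbreviation circle_measure :: "real measure" where
  "circle_measure \<equiv> restrict_space lborel {0..2*pi}"

interpretation circle: finite_measure circle_measure
  by (rule finite_measureI) (simp add: emeasure_restrict_space space_restrict_space)

interpretation torus: finite_measure "PiM {..<N} (\<lambda>_. circle_measure)" for N :: nat
proof -
  interpret product_sigma_finite "\<lambda>_::nat. circle_measure"
    by unfold_locales
  show "finite_measure (PiM {..<N} (\<lambda>_. circle_measure))"
  proof (rule finite_measureI)
    have "emeasure (PiM {..<N} (\<lambda>_. circle_measure)) (space (PiM {..<N} (\<lambda>_. circle_measure)))
        = (\<Prod>i<N. emeasure circle_measure (space circle_measure))"
      unfolding space_PiM by (rule emeasure_PiM) (simp, rule sets.top)
    also have "\<dots> < \<infinity>"
      by (simp only: prod_constant card_lessThan power_less_top_ennreal infinity_ennreal_def)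
        (simp add: less_top[symmetric] del: space_restrict_space2)
    finally show "emeasure (PiM {..<N} (\<lambda>_. circle_measure)) (space (PiM {..<N} (\<lambda>_. circle_measure))) \<noteq> \<infinity>"
      by simp
  qed
qed

lemma bdd_measurable_circle:
  assumes "0 < r" "continuous_on (sphere 0 r) f"
  shows "bdd_measurable circle_measure (\<lambda>\<theta>. f (of_real r * cis \<theta>))"
proof -
  have "continuous_on UNIV (\<lambda>\<theta>. f (of_real r * cis \<theta>))"
    by (rule continuous_on_compose2[OF assms(2)]) (use assms(1) in \<open>auto intro!: continuous_intros simp: norm_mult\<close>)
  then have "(\<lambda>\<theta>. f (of_real r * cis \<theta>)) \<in> borel_measurable circle_measure"
    by (intro measurable_restrict_space1) (simp add: borel_measurable_continuous_onI)
  moreover have "bounded (f ` sphere 0 r)"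
    by (intro compact_imp_bounded compact_continuous_image assms compact_sphere)
  then obtain B where "\<And>z. z \<in> sphere 0 r \<Longrightarrow> norm (f z) \<le> B"
    unfolding bounded_iff by blast
  then have "norm (f (of_real r * cis \<theta>)) \<le> B" for \<theta>
    using assms(1) by (simp add: norm_mult)
  ultimately show ?thesis unfolding bdd_measurable_def by blast
qed

lemma bdd_measurable_torus:
  assumes "0 < r" "continuous_on (sphere 0 r) f" "j < N"
  shows "bdd_measurable (PiM {..<N} (\<lambda>_. circle_measure)) (\<lambda>\<theta>. f (of_real r * cis (\<theta> j)))"
proof -
  have "(\<lambda>\<theta>. \<theta> j) \<in> measurable (PiM {..<N} (\<lambda>_. circle_measure)) circle_measure"
    using assms(3) by (intro measurable_component_singleton) simp
  moreover obtain B where "(\<lambda>\<theta>. f (of_real r * cis \<theta>)) \<in> borel_measurable circle_measure"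
    "\<And>\<theta>. \<theta> \<in> space circle_measure \<Longrightarrow> norm (f (of_real r * cis \<theta>)) \<le> B"
    using bdd_measurable_circle[OF assms(1,2)] unfolding bdd_measurable_def by blast
  ultimately show ?thesis
    unfolding bdd_measurable_def
    by (intro conjI exI[of _ B] ballI)
      (auto dest: measurable_space intro: measurable_compose simp del: space_restrict_space2)
qed

text \<open>The mean value property: in Cauchy's formula for \<open>f u / u\<close>, the factor
  \<open>u\<close> of \<open>du = \<i> u d\<theta>\<close> cancels the denominator.\<close>

lemma integral_circle_holomorphic:
  assumes f: "f holomorphic_on cball 0 r" and r: "0 < r"
  shows "(\<integral>\<theta>. f (of_real r * cis \<theta>) \<partial>circle_measure) = 2 * of_real pi * f 0"
proof -
  have "((\<lambda>u. f u / (u - 0)) has_contour_integral (2 * of_real pi * \<i> * f 0)) (circlepath 0 r)"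
    by (rule Cauchy_integral_circlepath_simple[OF f]) (use r in simp)
  then have "((\<lambda>t. f (0 + of_real r * cis t) / (0 + of_real r * cis t) * r * \<i> * cis t)
      has_integral (2 * of_real pi * \<i> * f 0)) {0..2*pi}"
    unfolding circlepath_def
    by (subst (asm) has_contour_integral_part_circlepath_iff) simp_all
  \<comment> \<open>The factor \<open>- \<i>\<close> removes the \<open>\<i>\<close> contributed by
    \<open>du\<close>.\<close>
  then have "((\<lambda>t. (f (of_real r * cis t) / (of_real r * cis t) * r * \<i> * cis t) * (- \<i>))
      has_integral (2 * of_real pi * \<i> * f 0) * (- \<i>)) {0..2*pi}"
    by (intro has_integral_mult_left) simp
  then have hi: "((\<lambda>t. f (of_real r * cis t)) has_integral (2 * of_real pi * f 0)) {0..2*pi}"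
    using r by (simp add: mult_ac)
  have "continuous_on {0..2*pi} (\<lambda>\<theta>. f (of_real r * cis \<theta>))"
    by (rule continuous_on_compose2[OF holomorphic_on_imp_continuous_on[OF f]])
      (use r in \<open>auto intro!: continuous_intros simp: norm_mult\<close>)
  then have "(LINT \<theta>:{0..2*pi}|lborel. f (of_real r * cis \<theta>)) = integral {0..2*pi} (\<lambda>\<theta>. f (of_real r * cis \<theta>))"
    by (intro set_borel_integral_eq_integral borel_integrable_atLeastAtMost')
  with integral_unique[OF hi] show ?thesis
    by (simp add: integral_restrict_space set_lebesgue_integral_def)
qed

subsection \<open>The solution of the backward equation\<close>

text \<open>Particles are indexed from 0 here and from 1 in the header: particle \<open>i\<close> is the header's \<open>i + 1\<close>.\<close>

definition bethe_row :: "nat \<Rightarrow> nat \<Rightarrow> int \<Rightarrow> complex \<Rightarrow> complex" where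
  "bethe_row k i y \<xi> = \<xi> powi (- y) * (1 - \<xi>) powi (if i < k then int i + 1 else int i)"

text \<open>For \<open>j < k\<close> this is the reciprocal of
  \<open>bethe_row k j (x + int j)\<close>, the row function of particle \<open>j\<close> at its
  target site.\<close>

definition bethe_col :: "int \<Rightarrow> nat \<Rightarrow> complex \<Rightarrow> complex" where
  "bethe_col x j \<xi> = \<xi> powi (x + int j) * (1 - \<xi>) powi (- (int j + 1))"

lemma bethe_row_shift:
  assumes "\<xi> \<noteq> 0"
  shows "bethe_row k i (y + 1) \<xi> = bethe_row k i y \<xi> * (1 / \<xi>)"
proof -
  have "\<xi> powi (- (y + 1)) = \<xi> powi (- y) * (1 / \<xi>)"
    using power_int_diff[of \<xi> "- y" 1] assms by simp
  then show ?thesis by (simp only: bethe_row_def mult_ac)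
qed

text \<open>This is \<open>1 = \<xi> + (1 - \<xi>)\<close> multiplied by
  \<open>\<xi> powi (- (y + 1)) * (1 - \<xi>) powi e\<close>. The exponent grows by one from row
  \<open>i\<close> to row \<open>Suc i\<close> except at \<open>Suc i = k\<close>.\<close>

lemma bethe_row_succ:
  assumes "\<xi> \<noteq> 0" "\<xi> \<noteq> 1" "Suc i \<noteq> k"
  shows "bethe_row k i (y + 1) \<xi> = bethe_row k i y \<xi> + bethe_row k (Suc i) (y + 1) \<xi>"
proof -
  define e where "e = (if i < k then int i + 1 else int i)"
  have "(if Suc i < k then int (Suc i) + 1 else int (Suc i)) = e + 1"
    using assms(3) by (auto simp: e_def)
  then have "bethe_row k (Suc i) (y + 1) \<xi> = \<xi> powi (- (y + 1)) * ((1 - \<xi>) powi e * (1 - \<xi>))"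
    unfolding bethe_row_def using power_int_add[of "1 - \<xi>" e 1] assms(2) by simp
  moreover have "\<xi> powi (- y) = \<xi> powi (- (y + 1)) * \<xi>"
    using power_int_add[of \<xi> "- (y + 1)" 1] assms(1) by simp
  ultimately show ?thesis
    unfolding bethe_row_def e_def[symmetric] by (simp add: algebra_simps)
qed

lemma bethe_row_kill: "bethe_row (Suc i) i y = bethe_row (Suc i) (Suc i) y"
  by (rule ext) (simp add: bethe_row_def add.commute)

lemma bethe_row_col:
  assumes "\<xi> \<noteq> 0" "\<xi> \<noteq> 1"
  shows "bethe_row k i y \<xi> * bethe_col x j \<xi> = \<xi> powi (- (y - x - int j)) *
    (1 - \<xi>) powi ((if i < k then int i + 1 else int i) - int j - 1)"
proof -
  have "\<xi> powi (- (y - x - int j)) = \<xi> powi (- y) * \<xi> powi (x + int j)"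
    using assms(1) by (simp flip: power_int_add add: algebra_simps)
  moreover have "(1 - \<xi>) powi (e - int j - 1) = (1 - \<xi>) powi e * (1 - \<xi>) powi (- (int j + 1))" for e
    using assms(2) by (simp flip: power_int_add add: algebra_simps)
  ultimately show ?thesis by (simp add: bethe_row_def bethe_col_def mult_ac)
qed

section \<open>Taylor coefficients of powers of \<open>1 - z\<close> as circle integrals\<close>

locale small_circle =
  fixes r :: real
  assumes r: "0 < r" "r < 1"
begin

abbreviation pt :: "real \<Rightarrow> complex" where
  "pt \<theta> \<equiv> of_real r * cis \<theta>"

lemma pt_nonzero: "pt \<theta> \<noteq> 0"
  using r by simp

lemma pt_neq_1: "pt \<theta> \<noteq> 1"
proof
  assume "pt \<theta> = 1"
  then have "norm (pt \<theta>) = 1" by simp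
  with r show False by (simp add: norm_mult)
qed

lemma sphere_neq:
  fixes z :: complex
  assumes "z \<in> sphere 0 r"
  shows "z \<noteq> 0" "1 - z \<noteq> 0"
proof -
  have "norm z = r" using assms by simp
  with r show "z \<noteq> 0" "1 - z \<noteq> 0" by auto
qed

lemma continuous_bethe_row: "continuous_on (sphere 0 r) (bethe_row k i y)"
  unfolding bethe_row_def[abs_def]
  by (intro continuous_intros disjI2 ballI sphere_neq)

lemma continuous_bethe_col: "continuous_on (sphere 0 r) (bethe_col x j)"
  unfolding bethe_col_def[abs_def]
  by (intro continuous_intros disjI2 ballI sphere_neq)

text \<open>This is \<open>2 * pi\<close> times the coefficient of order \<open>a\<close> in the
  expansion of \<open>(1 - z) powi m\<close> at 0; as \<open>r < 1\<close>, that reading covers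
  negative \<open>m\<close> too.\<close>

definition ct :: "int \<Rightarrow> int \<Rightarrow> complex" where
  "ct a m = (\<integral>\<theta>. pt \<theta> powi (- a) * (1 - pt \<theta>) powi m \<partial>circle_measure)"

lemma integrable_ct: "integrable circle_measure (\<lambda>\<theta>. pt \<theta> powi (- a) * (1 - pt \<theta>) powi m)"
  by (intro circle.integrable_bdd_measurable
      bdd_measurable_circle[of r "\<lambda>\<xi>. \<xi> powi (- a) * (1 - \<xi>) powi m"]
      continuous_intros r disjI2 ballI sphere_neq)

text \<open>With \<open>- a \<ge> 0\<close> the integrand is holomorphic in the disc, so its value
  at 0 decides.\<close>

lemma ct_nonpos:
  assumes "a \<le> 0"
  shows "ct a m = (if a = 0 then 2 * of_real pi else 0)"
proof -
  have "(\<lambda>\<xi>::complex. \<xi> powi (- a) * (1 - \<xi>) powi m) holomorphic_on cball 0 r"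
    by (intro holomorphic_intros) (use r assms in auto)
  from integral_circle_holomorphic[OF this r(1)] show ?thesis
    by (simp add: ct_def power_int_0_left_if)
qed

text \<open>On the circle the inverse of a point is its conjugate over \<open>r\<^sup>2\<close>. Up
  to a constant the integral is therefore the conjugate of the one for \<open>- a\<close>, which
  \<open>ct_nonpos\<close> evaluates.\<close>

lemma ct_pos_0:
  assumes "0 < a"
  shows "ct a 0 = 0"
proof -
  obtain n where a: "a = int n" using assms zero_le_imp_eq_int[of a] by auto
  have eq: "pt \<theta> powi (- a) = cnj (pt \<theta> ^ n) * of_real (1 / r\<^sup>2) ^ n" for \<theta>
  proof -
    have "inverse (pt \<theta>) = cnj (pt \<theta>) * of_real (1 / r\<^sup>2)"
      using r by (simp add: field_simps power2_eq_square cis_cnj cis_inverse cis_mult)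
    moreover have "pt \<theta> powi (- a) = inverse (pt \<theta>) ^ n"
      by (simp only: a power_int_minus power_int_of_nat power_inverse)
    ultimately show ?thesis
      by (simp only: power_mult_distrib[of "cnj (pt \<theta>)"] complex_cnj_power)
  qed
  have "ct a 0 = cnj (\<integral>\<theta>. pt \<theta> ^ n \<partial>circle_measure) * of_real (1 / r\<^sup>2) ^ n"
    unfolding ct_def eq by (simp del: complex_cnj_power complex_cnj_mult)
  also have "(\<integral>\<theta>. pt \<theta> ^ n \<partial>circle_measure) = ct (- a) 0"
    by (simp add: ct_def a)
  finally show ?thesis using ct_nonpos[of "- a" 0] assms by simp
qed

text \<open>Pascal's rule, obtained by splitting one factor \<open>1 - z\<close>.\<close>

lemma ct_rec: "ct a (m + 1) = ct a m - ct (a - 1) m"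
proof -
  have "pt \<theta> powi (- a) * (1 - pt \<theta>) powi (m + 1)
      = pt \<theta> powi (- a) * (1 - pt \<theta>) powi m - pt \<theta> powi (- (a - 1)) * (1 - pt \<theta>) powi m" for \<theta>
  proof -
    define p where "p = pt \<theta>"
    have p: "p \<noteq> 0" "p \<noteq> 1" using pt_nonzero pt_neq_1 by (simp_all add: p_def)
    have "(1 - p) powi (m + 1) = (1 - p) powi m * (1 - p)"
      using power_int_add[of "1 - p" m 1] p by simp
    moreover have "p powi (- (a - 1)) = p powi (- a) * p"
      using power_int_add[of p "- a" 1] p by simp
    ultimately show ?thesis
      unfolding p_def[symmetric] by (simp only: left_diff_distrib right_diff_distrib mult_ac mult_1_left mult_1_right)
  qed
  then show ?thesis
    unfolding ct_def using integrable_ct[of a m] integrable_ct[of "a - 1" m]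
    by (simp only: Bochner_Integration.integral_diff)
qed

lemma ct_above_degree: "int m < a \<Longrightarrow> ct a (int m) = 0"
proof (induction m arbitrary: a)
  case 0
  then show ?case by (simp add: ct_pos_0)
next
  case (Suc m)
  then show ?case using ct_rec[of a "int m"] Suc.IH[of a] Suc.IH[of "a - 1"] by (simp add: add.commute)
qed

text \<open>These are the coefficients of the geometric series: \<open>ct_rec\<close> at
  \<open>m = - 1\<close> equates consecutive ones, because the constant 1 has no coefficients of
  positive order.\<close>

lemma ct_geometric: "ct (int n) (- 1) = 2 * of_real pi"
proof (induction n)
  case 0
  then show ?case by (simp add: ct_nonpos)
next
  case (Suc n)
  then show ?case using ct_rec[of "int (Suc n)" "- 1"] ct_pos_0[of "int (Suc n)"] by simp
qed

text \<open>When the first \<open>k\<close> particles sit on their targets, division by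
  \<open>2 * pi\<close> gives a unit diagonal. Otherwise the first misplaced particle
  \<open>m\<close> decides: left of its target it yields a zero row, right of it a zero
  column.\<close>

lemma ct_initial:
  assumes "1 \<le> k" "k \<le> N" and incr: "\<And>i. Suc i < N \<Longrightarrow> y i < y (Suc i)"
  shows "fdet N (\<lambda>i j. ct (y i - x - int j) ((if i < k then int i + 1 else int i) - int j - 1))
    = (if \<forall>i<k. y i = x + int i then (2 * of_real pi) ^ N else 0)" (is "fdet N ?M = _")
proof -
  have gap: "y i + int d \<le> y (i + d)" if "i + d < N" for i d
    using that
  proof (induction d)
    case (Suc d)
    then show ?case using incr[of "i + d"] by simp
  qed simp
  have gap': "y i + int (j - i) \<le> y j" if "i \<le> j" "j < N" for i j
    using gap[of i "j - i"] that by simp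
  show ?thesis
  proof (cases "\<forall>i<k. y i = x + int i")
    case True
    have ge: "x + int i \<le> y i" if "i < N" "k \<le> i" for i
    proof -
      have "y (k - 1) = x + int (k - 1)" using True assms(1) by simp
      then show ?thesis using gap'[of "k - 1" i] that by auto
    qed
    define M where "M i j = ?M i j * (1 / (2 * of_real pi))" for i j
    have "fdet N M = 1"
    proof (rule fdet_block_triangular[of k])
      fix i j assume "i < k" "i < j" "j < N"
      then have "ct (y i - x - int j) (int i + 1 - int j - 1) = 0"
        using True by (subst ct_nonpos) auto
      with \<open>i < k\<close> show "M i j = 0" by (simp add: M_def)
    next
      fix i j assume ij: "k \<le> i" "i < N" "j < i"
      \<comment> \<open>As \<open>j < i\<close>, the truncated subtraction is exact; the degree
        \<open>i - j - 1\<close> lies below the order, which is at least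
        \<open>i - j\<close>.\<close>
      have eq: "int (i - j - 1) = int i - int j - 1" using ij by simp
      have "int (i - j - 1) < y i - x - int j" using ge[of i] ij by simp
      from ct_above_degree[OF this] have "ct (y i - x - int j) (int i - int j - 1) = 0"
        unfolding eq .
      with ij show "M i j = 0" by (simp add: M_def)
    next
      fix i assume "i < N"
      show "M i i = 1"
      proof (cases "i < k")
        case True
        with \<open>\<forall>i<k. y i = x + int i\<close> show ?thesis by (simp add: M_def ct_nonpos)
      next
        case False
        then show ?thesis
          \<comment> \<open>Here the exponent is \<open>- 1\<close> and the order is some
            nonnegative number, which is why all coefficients of the geometric series are
            needed.\<close>
          using ct_geometric[of "nat (y i - x - int i)"] ge[of i] \<open>i < N\<close> by (simp add: M_def)
      qed
    qed
    moreover have "fdet N M = fdet N ?M * (1 / (2 * of_real pi)) ^ N"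
      unfolding M_def[abs_def] by (subst fdet_scale_cols) simp
    ultimately show ?thesis using True by (simp add: field_simps)
  next
    case False
    define m where "m = (LEAST i. i < k \<and> y i \<noteq> x + int i)"
    have m: "m < k" "y m \<noteq> x + int m"
      using LeastI_ex[of "\<lambda>i. i < k \<and> y i \<noteq> x + int i"] False unfolding m_def by auto
    have least: "y i = x + int i" if "i < m" for i
      using not_less_Least[of i "\<lambda>i. i < k \<and> y i \<noteq> x + int i"] that m(1) unfolding m_def[symmetric] by auto
    have "m < N" using m(1) assms(2) by simp
    have "fdet N ?M = 0"
    proof (cases "y m < x + int m")
      case True
      \<comment> \<open>A predecessor on its target would force \<open>y m\<close> to be at least
        \<open>x + int m\<close>. With \<open>m = 0\<close>, all orders in row 0 are
        negative.\<close>
      have "m = 0"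
      proof (rule ccontr)
        assume "m \<noteq> 0"
        then show False
          using gap'[of "m - 1" m] least[of "m - 1"] \<open>m < N\<close> True by auto
      qed
      show ?thesis
        by (rule fdet_zero_row[of 0]) (use True \<open>m = 0\<close> \<open>m < N\<close> in \<open>auto simp: ct_nonpos\<close>)
    next
      case False
      show ?thesis
      proof (rule fdet_zero_col[OF \<open>m < N\<close>])
        fix i assume "i < N"
        show "?M i m = 0"
        proof (cases "i < m")
          case True
          then show ?thesis using least[OF True] m(1) by (simp add: ct_nonpos)
        next
          case ge: False
          \<comment> \<open>The order exceeds \<open>i - m\<close>, hence also the degree, which is
            \<open>i - m\<close> for \<open>i < k\<close> and \<open>i - m - 1\<close> from
            \<open>k\<close> on.\<close>
          have less: "int (i - m) < y i - x - int m"
            using gap'[of m i] ge \<open>i < N\<close> False m(2) by simp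
          show ?thesis
          proof (cases "i < k")
            case True
            then show ?thesis using ct_above_degree[OF less] ge by (simp add: of_nat_diff)
          next
            case nk: False
            then have "int (i - m - 1) = int i - int m - 1" using m(1) by simp
            then show ?thesis using ct_above_degree[of "i - m - 1" "y i - x - int m"] less nk by simp
          qed
        qed
      qed
    qed
    with False show ?thesis by (simp split: if_splits)
  qed
qed


text \<open>For increasing \<open>y\<close> this is \<open>(2 * pi) ^ N * N ^ n\<close> times the
  probability of the event after \<open>n\<close> steps of the chain. It makes sense for all
  \<open>y\<close>, because the collision rules live at coinciding positions.\<close>

definition backward :: "nat \<Rightarrow> nat \<Rightarrow> int \<Rightarrow> nat \<Rightarrow> (nat \<Rightarrow> int) \<Rightarrow> complex" where
  "backward N k x n y = (\<integral>\<theta>. (\<Sum>j<N. 1 / pt (\<theta> j)) ^ n *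
      (fdet N (\<lambda>i j. bethe_row k i (y i) (pt (\<theta> j))) * (\<Prod>j<N. bethe_col x j (pt (\<theta> j))))
    \<partial>PiM {..<N} (\<lambda>_. circle_measure))"

lemma bdd_measurable_sum_inverse:
  "bdd_measurable (PiM {..<N} (\<lambda>_. circle_measure)) (\<lambda>\<theta>. \<Sum>j<N. 1 / pt (\<theta> j))"
proof (intro bdd_measurable_sum)
  fix j assume "j \<in> {..<N}"
  then show "bdd_measurable (PiM {..<N} (\<lambda>_. circle_measure)) (\<lambda>\<theta>. 1 / pt (\<theta> j))"
    by (intro bdd_measurable_torus[of r "\<lambda>\<xi>. 1 / \<xi>"] r continuous_intros) (use sphere_neq in auto)
qed

lemma bdd_measurable_backward:
  "bdd_measurable (PiM {..<N} (\<lambda>_. circle_measure)) (\<lambda>\<theta>.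
    fdet N (\<lambda>i j. bethe_row k i (y i) (pt (\<theta> j))) * (\<Prod>j<N. bethe_col x j (pt (\<theta> j))))"
  by (intro bdd_measurable_mult bdd_measurable_fdet bdd_measurable_prod bdd_measurable_torus
      continuous_bethe_row continuous_bethe_col r) simp_all

lemma backward_cong:
  assumes "\<And>\<theta>. fdet N (\<lambda>i j. bethe_row k i (y i) (pt (\<theta> j))) = fdet N (\<lambda>i j. bethe_row k i (z i) (pt (\<theta> j)))"
  shows "backward N k x n y = backward N k x n z"
  using assms by (simp add: backward_def)

text \<open>One factor of the symmetric sum scales each row in turn by \<open>1 / \<xi>\<close>,
  that is, shifts each \<open>y i\<close> in turn: the evolution of free particles.\<close>

lemma backward_Suc:
  "backward N k x (Suc n) y = (\<Sum>i<N. backward N k x n (y(i := y i + 1)))"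
proof -
  let ?M = "PiM {..<N} (\<lambda>_. circle_measure)"
  let ?S = "\<lambda>\<theta>. \<Sum>j<N. 1 / pt (\<theta> j)"
  let ?D = "\<lambda>y \<theta>. fdet N (\<lambda>i j. bethe_row k i (y i) (pt (\<theta> j)))"
  let ?P = "\<lambda>\<theta>. \<Prod>j<N. bethe_col x j (pt (\<theta> j))"
  have "?S \<theta> * ?D y \<theta> = (\<Sum>i<N. ?D (y(i := y i + 1)) \<theta>)" for \<theta>
    unfolding sum_fdet_scale_row[symmetric]
    by (intro sum.cong refl fdet_cong) (simp add: bethe_row_shift[OF pt_nonzero])
  then have eq: "?S \<theta> ^ Suc n * (?D y \<theta> * ?P \<theta>)
      = (\<Sum>i<N. ?S \<theta> ^ n * (?D (y(i := y i + 1)) \<theta> * ?P \<theta>))" for \<theta>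
    by (simp only: power_Suc2 mult.assoc sum_distrib_left[symmetric] sum_distrib_right[symmetric])
      (simp only: mult.assoc[symmetric])
  show ?thesis
    unfolding backward_def eq
    by (intro Bochner_Integration.integral_sum torus.integrable_bdd_measurable bdd_measurable_mult
        bdd_measurable_power bdd_measurable_sum_inverse bdd_measurable_backward)
qed

lemma backward_0:
  assumes "1 \<le> k" "k \<le> N" "\<And>i. Suc i < N \<Longrightarrow> y i < y (Suc i)"
  shows "backward N k x 0 y = (if \<forall>i<k. y i = x + int i then (2 * of_real pi) ^ N else 0)"
proof -
  have int: "integrable circle_measure (\<lambda>\<theta>. bethe_row k i (y i) (pt \<theta>) * bethe_col x j (pt \<theta>))" for i j
    unfolding bethe_row_col[OF pt_nonzero pt_neq_1] by (rule integrable_ct)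
  \<comment> \<open>At \<open>n = 0\<close> the coupling factor is gone, and the integral separates
    into the variables.\<close>
  have "backward N k x 0 y = fdet N (\<lambda>i j. \<integral>\<theta>. bethe_row k i (y i) (pt \<theta>) * bethe_col x j (pt \<theta>) \<partial>circle_measure)"
    unfolding backward_def power_0 mult_1_left
    by (rule integral_fdet_prod) (unfold_locales, rule int)
  also have "\<dots> = (if \<forall>i<k. y i = x + int i then (2 * of_real pi) ^ N else 0)"
    unfolding bethe_row_col[OF pt_nonzero pt_neq_1] ct_def[symmetric]
    by (rule ct_initial[OF assms(1,2)]) (rule assms(3))
  finally show ?thesis .
qed

end

subsection \<open>The jump chain\<close>

text \<open>Associativity of bind pulls any initial law out of the iteration; for the law after one
  step this splits off the first jump, as a backward equation requires.\<close>

lemma jump_chain_bind: "((\<lambda>q. bind_pmf q jump_step) ^^ n) q = bind_pmf q (jump_chain n)"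
proof (induction n arbitrary: q)
  case (Suc n)
  have "((\<lambda>q. bind_pmf q jump_step) ^^ Suc n) q = bind_pmf (bind_pmf q (jump_chain n)) jump_step"
    by (simp add: Suc)
  also have "\<dots> = bind_pmf q (\<lambda>s. bind_pmf (jump_chain n s) jump_step)"
    by (rule bind_assoc_pmf)
  finally show ?case by (simp add: jump_chain_def)
next
  case 0
  have "jump_chain 0 = return_pmf" by (rule ext) (simp add: jump_chain_def)
  then show ?case by (simp add: bind_return_pmf')
qed

lemma prob_jump_chain_Suc:
  assumes "X \<noteq> []"
  shows "measure_pmf.prob (jump_chain (Suc n) (X, p)) A
    = (\<Sum>i<length X. measure_pmf.prob (jump_chain n (attempt i (X, p))) A) / length X"
proof -
  let ?f = "\<lambda>s. measure_pmf.prob (jump_chain n s) A"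
  have "jump_chain (Suc n) (X, p) = bind_pmf (jump_step (X, p)) (jump_chain n)"
    unfolding jump_chain_bind[symmetric] unfolding jump_chain_def funpow_Suc_right
    by (simp add: bind_return_pmf)
  \<comment> \<open>The measure of a bind is a nonnegative integral, so the computation passes
    through \<open>ennreal\<close> before becoming an average over the chosen particle.\<close>
  then have "ennreal (measure_pmf.prob (jump_chain (Suc n) (X, p)) A)
      = (\<integral>\<^sup>+i. ennreal (?f (attempt i (X, p))) \<partial>pmf_of_set {..<length X})"
    by (simp add: jump_step_def measure_pmf.emeasure_eq_measure[symmetric])
  also have "\<dots> = ennreal (\<integral>i. ?f (attempt i (X, p)) \<partial>pmf_of_set {..<length X})"
    by (intro nn_integral_eq_integral measure_pmf.integrable_const_bound[where B = 1]) auto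
  also have "(\<integral>i. ?f (attempt i (X, p)) \<partial>pmf_of_set {..<length X})
      = (\<Sum>i<length X. ?f (attempt i (X, p))) / length X"
    using assms by (subst integral_pmf_of_set) auto
  finally show ?thesis
    by (subst (asm) ennreal_inj) (auto intro!: divide_nonneg_nonneg sum_nonneg)
qed

lemma attempt_eq:
  "attempt i (X, p) = (if Suc i < length X \<and> X ! Suc i = X ! i + 1 then
      (X, if p ! i = 2 \<and> p ! Suc i = 1 then p[i := 1, Suc i := 2] else p)
     else (X[i := X ! i + 1], p))"
  by (simp add: attempt_def)

lemma length_nu: "k \<le> N \<Longrightarrow> length (nu N k) = N"
  by (simp add: nu_def)

lemma nth_nu: "k \<le> N \<Longrightarrow> i < N \<Longrightarrow> nu N k ! i = (if i < k then 2 else 1)"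
  by (simp add: nu_def nth_append)

text \<open>A swap puts a 1 immediately before a 2, whereas in \<open>nu N k\<close> every 2
  precedes every 1.\<close>

lemma swap_neq_nu:
  assumes "k \<le> N" "Suc i < N"
  shows "p[i := 1, Suc i := 2] \<noteq> nu N k"
proof
  assume eq: "p[i := 1, Suc i := 2] = nu N k"
  then have "length p = N" using length_nu[OF assms(1)] by (metis length_list_update)
  then have "nu N k ! i = 1" "nu N k ! Suc i = 2"
    unfolding eq[symmetric] using assms(2) by simp_all
  moreover have "nu N k ! i = (if i < k then 2 else 1)" "nu N k ! Suc i = (if Suc i < k then 2 else 1)"
    by (rule nth_nu; use assms in simp)+
  ultimately have "\<not> i < k" "Suc i < k" by (metis num.distinct(1) numeral_eq_one_iff)+
  then show False by simp
qed

text \<open>Labels change only through swaps, and no swap produces \<open>nu N k\<close>.\<close>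

lemma prob_other_labels:
  assumes "k \<le> N" "length X = N" "X \<noteq> []" "p \<noteq> nu N k"
  shows "measure_pmf.prob (jump_chain n (X, p)) (E_event N k x) = 0"
  using assms(2-)
proof (induction n arbitrary: X p)
  case 0
  then show ?case by (simp add: jump_chain_def E_event_def measure_return_pmf)
next
  case (Suc n)
  have "measure_pmf.prob (jump_chain n (attempt i (X, p))) (E_event N k x) = 0" if "i < length X" for i
    unfolding attempt_eq using Suc swap_neq_nu[OF assms(1), of i p] by auto
  then show ?case using Suc.prems by (simp add: prob_jump_chain_Suc)
qed


text \<open>In \<open>nu N k\<close> the labels at \<open>i\<close> and \<open>Suc i\<close> differ
  only for \<open>k = Suc i\<close>, so an occupied site ahead leads to a swap there and to a
  suppressed jump elsewhere.\<close>

lemma attempt_cases: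
  assumes "k \<le> N" "length X = N" "i < N"
  obtains (kill) "Suc i < N" "X ! Suc i = X ! i + 1" "k = Suc i" "snd (attempt i (X, nu N k)) \<noteq> nu N k"
      "length (fst (attempt i (X, nu N k))) = N"
    | (block) "Suc i < N" "X ! Suc i = X ! i + 1" "k \<noteq> Suc i" "attempt i (X, nu N k) = (X, nu N k)"
    | (jump) "Suc i < N \<Longrightarrow> X ! Suc i \<noteq> X ! i + 1"
      "attempt i (X, nu N k) = (X[i := X ! i + 1], nu N k)"
proof (cases "Suc i < N \<and> X ! Suc i = X ! i + 1")
  case False
  with assms(2) show ?thesis by (intro jump) (auto simp: attempt_eq)
next
  case True
  have nus: "nu N k ! i = (if i < k then 2 else 1)" "nu N k ! Suc i = (if Suc i < k then 2 else 1)"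
    by (rule nth_nu; use assms True in simp)+
  show ?thesis
  proof (cases "k = Suc i")
    case k: True
    have "attempt i (X, nu N k) = (X, (nu N k)[i := 1, Suc i := 2])"
      unfolding attempt_eq using True assms(2) nus k by simp
    then show ?thesis
      using True k assms(2) swap_neq_nu[OF assms(1), of i "nu N k"] by (intro kill) auto
  next
    case k: False
    have "attempt i (X, nu N k) = (X, nu N k)"
      unfolding attempt_eq using True assms(2) nus k by auto
    then show ?thesis using True k by (intro block) auto
  qed
qed

section \<open>Collision rules, induction on the number of steps and Poisson summation\<close>

context small_circle
begin

text \<open>The shift brings both particles to one site, and their rows carry the same power of
  \<open>1 - \<xi>\<close>, so the two rows coincide.\<close>

lemma backward_kill:
  assumes "Suc i < N" "k = Suc i" "y (Suc i) = y i + 1"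
  shows "backward N k x n (y(i := y i + 1)) = 0"
proof -
  have "fdet N (\<lambda>l j. bethe_row k l ((y(i := y i + 1)) l) (pt (\<theta> j))) = 0" for \<theta>
    by (rule fdet_equal_rows[of i _ "Suc i"]) (use assms bethe_row_kill[of i "y i + 1"] in auto)
  then show ?thesis by (simp only: backward_def mult_zero_left mult_zero_right integral_zero)
qed

text \<open>By \<open>bethe_row_succ\<close> the shifted row is the old row plus the next one, which
  a row operation removes: the formal shift acts like a suppressed jump.\<close>

lemma backward_block:
  assumes "Suc i < N" "k \<noteq> Suc i" "y (Suc i) = y i + 1"
  shows "backward N k x n (y(i := y i + 1)) = backward N k x n y"
proof (rule backward_cong)
  fix \<theta> :: "nat \<Rightarrow> real"
  let ?M = "\<lambda>l j. bethe_row k l (y l) (pt (\<theta> j))"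
  have "fdet N (\<lambda>l j. bethe_row k l ((y(i := y i + 1)) l) (pt (\<theta> j)))
      = fdet N (\<lambda>l j. if l = i then ?M i j + 1 * ?M (Suc i) j else ?M l j)"
    using assms by (intro fdet_cong) (simp add: bethe_row_succ[OF pt_nonzero pt_neq_1])
  also have "\<dots> = fdet N ?M"
    using assms(1) by (intro fdet_addrow) auto
  finally show "fdet N (\<lambda>l j. bethe_row k l ((y(i := y i + 1)) l) (pt (\<theta> j))) = fdet N ?M" .
qed

text \<open>Induction on \<open>n\<close> for all ordered \<open>X\<close> at once. The chain
  averages over \<open>N\<close> attempts while \<open>backward_Suc\<close> sums over
  \<open>N\<close> shifts, hence the factor \<open>N ^ n\<close>.\<close>

lemma prob_jump_chain_backward:
  assumes k: "1 \<le> k" "k \<le> N" and X: "length X = N" and incr: "\<And>i. Suc i < N \<Longrightarrow> X ! i < X ! Suc i"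
  shows "of_real (measure_pmf.prob (jump_chain n (X, nu N k)) (E_event N k x)) * of_nat N ^ n
      * (2 * of_real pi) ^ N = backward N k x n (nth X)"
  using X incr
proof (induction n arbitrary: X)
  case 0
  have "measure_pmf.prob (jump_chain 0 (X, nu N k)) (E_event N k x) = (if \<forall>i<k. X ! i = x + int i then 1 else 0)"
    using 0 by (simp add: jump_chain_def E_event_def measure_return_pmf)
  then show ?case using backward_0[OF k, of "nth X" x] 0 by simp
next
  case (Suc n)
  let ?p = "\<lambda>s. measure_pmf.prob (jump_chain n s) (E_event N k x)"
  have "X \<noteq> []" "N \<noteq> 0" using Suc.prems k by auto
  \<comment> \<open>A shift of coordinate \<open>i\<close> stands for the attempt even where no
    particle advances: after a swap both sides vanish, and a suppressed jump keeps the value at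
    \<open>X\<close>.\<close>
  have step: "of_real (?p (attempt i (X, nu N k))) * of_nat N ^ n * (2 * of_real pi) ^ N
      = backward N k x n ((nth X)(i := X ! i + 1))" if "i < N" for i
    using k(2) Suc.prems(1) \<open>i < N\<close>
  proof (cases rule: attempt_cases)
    case kill
    then obtain X' p where a: "attempt i (X, nu N k) = (X', p)" "p \<noteq> nu N k" "length X' = N"
      by (metis fst_conv prod.collapse snd_conv)
    then have "?p (attempt i (X, nu N k)) = 0"
      using \<open>N \<noteq> 0\<close> k(2) by (auto intro!: prob_other_labels)
    then show ?thesis using backward_kill[of i N k "nth X"] kill by simp
  next
    case block
    then show ?thesis using backward_block[of i N k "nth X"] Suc by simp
  next
    case jump
    \<comment> \<open>Strict order survives because the site ahead is vacant.\<close>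
    have "X[i := X ! i + 1] ! l < X[i := X ! i + 1] ! Suc l" if "Suc l < N" for l
      using Suc.prems(2)[OF that] jump(1) that Suc.prems(1) \<open>i < N\<close> by (auto simp: nth_list_update)
    then have "of_real (?p (X[i := X ! i + 1], nu N k)) * of_nat N ^ n * (2 * of_real pi) ^ N
        = backward N k x n (nth (X[i := X ! i + 1]))"
      using Suc.prems(1) by (intro Suc.IH) simp_all
    also have "\<dots> = backward N k x n ((nth X)(i := X ! i + 1))"
      by (intro backward_cong fdet_cong) (use Suc.prems(1) in \<open>simp add: nth_list_update\<close>)
    finally show ?thesis by (simp only: jump(2))
  qed
  have "of_real (measure_pmf.prob (jump_chain (Suc n) (X, nu N k)) (E_event N k x)) * of_nat N ^ Suc n
      * (2 * of_real pi) ^ N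
      = (\<Sum>i<N. of_real (?p (attempt i (X, nu N k))) * of_nat N ^ n * (2 * of_real pi) ^ N :: complex)"
    using Suc.prems(1) \<open>N \<noteq> 0\<close>
    by (simp add: prob_jump_chain_Suc[OF \<open>X \<noteq> []\<close>] sum_distrib_left field_simps)
  also have "\<dots> = backward N k x (Suc n) (nth X)"
    unfolding backward_Suc by (intro sum.cong refl step) simp
  finally show ?case .
qed

text \<open>The power \<open>N ^ n\<close> in the Poisson weights is the one in
  \<open>prob_jump_chain_backward\<close>; what remains is an exponential series under the
  integral.\<close>

lemma tasep_prob_eq:
  assumes k: "1 \<le> k" "k \<le> N" and X: "length X = N" and incr: "\<And>i. Suc i < N \<Longrightarrow> X ! i < X ! Suc i"
  shows "complex_of_real (tasep_prob t (X, nu N k) (E_event N k x)) = 1 / (2 * of_real pi) ^ N *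
    (\<integral>\<theta>. exp (of_real t * (\<Sum>j<N. 1 / pt (\<theta> j)) - of_real t * of_nat N) *
      (fdet N (\<lambda>i j. bethe_row k i (X ! i) (pt (\<theta> j))) * (\<Prod>j<N. bethe_col x j (pt (\<theta> j))))
    \<partial>PiM {..<N} (\<lambda>_. circle_measure))"
proof -
  let ?M = "PiM {..<N} (\<lambda>_. circle_measure)"
  let ?S = "\<lambda>\<theta>. \<Sum>j<N. 1 / pt (\<theta> j)"
  let ?F = "\<lambda>\<theta>. fdet N (\<lambda>i j. bethe_row k i (X ! i) (pt (\<theta> j))) * (\<Prod>j<N. bethe_col x j (pt (\<theta> j)))"
  let ?p = "\<lambda>n. measure_pmf.prob (jump_chain n (X, nu N k)) (E_event N k x)"
  define c :: complex where "c = exp (- (of_real t * of_nat N)) / (2 * of_real pi) ^ N"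
  define a where "a n = exp (- real N * t) * (real N * t) ^ n / fact n * ?p n" for n
  have pi_ne: "(2 * complex_of_real pi) ^ N \<noteq> 0" by simp
  have int: "(\<integral>\<theta>. (of_real t * ?S \<theta>) ^ n / fact n * ?F \<theta> \<partial>?M)
      = of_real t ^ n / fact n * backward N k x n (nth X)" for n
    unfolding backward_def integral_mult_right_zero[symmetric]
    by (simp only: power_mult_distrib times_divide_eq_left times_divide_eq_right mult.assoc)
  have "of_real (a n) = c * (\<integral>\<theta>. (of_real t * ?S \<theta>) ^ n / fact n * ?F \<theta> \<partial>?M)" for n
    using prob_jump_chain_backward[OF k X, of n x] incr pi_ne unfolding int
    by (simp add: a_def c_def power_mult_distrib exp_of_real[symmetric] field_simps)
  moreover have "(\<lambda>n. c * (\<integral>\<theta>. (of_real t * ?S \<theta>) ^ n / fact n * ?F \<theta> \<partial>?M)) sums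
      (c * (\<integral>\<theta>. exp (of_real t * ?S \<theta>) * ?F \<theta> \<partial>?M))"
    by (intro sums_mult torus.sums_integral_exp bdd_measurable_mult[of _ "\<lambda>_. of_real t"]
        bdd_measurable_const bdd_measurable_sum_inverse bdd_measurable_backward)
  ultimately have sums: "(\<lambda>n. complex_of_real (a n)) sums (c * (\<integral>\<theta>. exp (of_real t * ?S \<theta>) * ?F \<theta> \<partial>?M))"
    by simp
  have "tasep_prob t (X, nu N k) (E_event N k x) = suminf a"
    by (simp add: tasep_prob_def a_def[abs_def] X Let_def)
  \<comment> \<open>Summability of the real series is read off the complex one, so that
    \<open>suminf_of_real\<close> applies.\<close>
  moreover have "summable a"
    using sums_Re[OF sums] by (simp add: sums_iff)
  ultimately have "complex_of_real (tasep_prob t (X, nu N k) (E_event N k x))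
      = c * (\<integral>\<theta>. exp (of_real t * ?S \<theta>) * ?F \<theta> \<partial>?M)"
    using sums_unique[OF sums] by (simp add: suminf_of_real)
  also have "\<dots> = 1 / (2 * of_real pi) ^ N *
      (\<integral>\<theta>. exp (of_real t * ?S \<theta> - of_real t * of_nat N) * ?F \<theta> \<partial>?M)"
    unfolding c_def exp_diff exp_minus
    by (simp add: divide_inverse mult_ac flip: integral_mult_right_zero)
  finally show ?thesis .
qed

end

subsection \<open>Step initial condition\<close>

text \<open>With \<open>v = 1 / \<xi> - 1\<close>, rows below \<open>k\<close> are pure powers of
  \<open>v\<close>; the others are \<open>v ^ i / \<xi>\<close>, and
  \<open>1 / \<xi> = v + 1\<close> splits them in two.\<close>

lemma bethe_row_step:
  assumes "\<xi> \<noteq> 0" "\<xi> \<noteq> 1"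
  shows "bethe_row k i (int i + 1) \<xi>
    = (1 / \<xi> - 1) ^ Suc i + (if k \<le> i then (1 / \<xi> - 1) ^ i else 0)"
proof -
  have v: "1 / \<xi> - 1 = (1 - \<xi>) / \<xi>" using assms by (simp add: field_simps)
  have h1: "\<xi> powi (- (int i + 1)) = 1 / \<xi> ^ Suc i"
    using power_int_minus[of \<xi> "int (Suc i)"] power_int_of_nat[of \<xi> "Suc i"]
    by (simp add: add.commute field_simps)
  have h2: "(1 - \<xi>) powi (int i + 1) = (1 - \<xi>) ^ Suc i"
    using power_int_of_nat[of "1 - \<xi>" "Suc i"] by (simp add: add.commute)
  have "bethe_row k i (int i + 1) \<xi> = 1 / \<xi> ^ Suc i * (if i < k then (1 - \<xi>) ^ Suc i else (1 - \<xi>) ^ i)"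
    by (cases "i < k") (simp_all only: bethe_row_def h1 h2 if_True if_False power_int_of_nat)
  then show ?thesis
    using assms unfolding v by (auto simp: power_divide field_simps)
qed

lemma bethe_col_eq:
  assumes "\<xi> \<noteq> 0" "\<xi> \<noteq> 1"
  shows "bethe_col x j \<xi> = (\<xi> / (1 - \<xi>)) ^ j * (\<xi> powi x / (1 - \<xi>))"
proof -
  have "(1 - \<xi>) powi (- (int j + 1)) = 1 / (1 - \<xi>) ^ Suc j"
    using power_int_minus[of "1 - \<xi>" "int (Suc j)"] power_int_of_nat[of "1 - \<xi>" "Suc j"]
    by (simp add: add.commute field_simps)
  moreover have "\<xi> powi (x + int j) = \<xi> powi x * \<xi> ^ j"
    using power_int_add[of \<xi> x "int j"] assms by simp
  ultimately show ?thesis by (simp add: bethe_col_def power_divide mult_ac)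
qed

text \<open>The second term in a row \<open>i \<ge> k\<close> is the main term of row
  \<open>i - 1\<close>, so row operations remove it. Here the dependence on \<open>k\<close>
  disappears.\<close>

lemma fdet_bethe_row_step:
  assumes "\<And>j. j < N \<Longrightarrow> \<xi> j \<noteq> 0 \<and> \<xi> j \<noteq> 1" "1 \<le> k"
  shows "fdet N (\<lambda>i j. bethe_row k i (int i + 1) (\<xi> j))
    = (\<Prod>i<N. \<Prod>j\<in>{i<..<N}. (1 / \<xi> j - 1) - (1 / \<xi> i - 1)) * (\<Prod>j<N. 1 / \<xi> j - 1)"
proof -
  let ?v = "\<lambda>j. 1 / \<xi> j - 1"
  have "fdet N (\<lambda>i j. bethe_row k i (int i + 1) (\<xi> j))
      = fdet N (\<lambda>i j. ?v j ^ Suc i + (if k \<le> i then 1 * ?v j ^ Suc (i - 1) else 0))"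
    using assms by (intro fdet_cong) (auto simp: bethe_row_step)
  also have "\<dots> = fdet N (\<lambda>i j. ?v j ^ i * ?v j)"
    using fdet_add_prev_rows[OF assms(2), of N "\<lambda>i j. ?v j ^ Suc i" 1] by (simp only: power_Suc2)
  also have "\<dots> = fdet N (\<lambda>i j. ?v j ^ i) * (\<Prod>j<N. ?v j)"
    by (rule fdet_scale_cols)
  finally show ?thesis by (simp only: vandermonde)
qed

lemma fdet_bethe_col:
  assumes "\<And>j. j < N \<Longrightarrow> \<xi> j \<noteq> 0 \<and> \<xi> j \<noteq> 1"
  shows "fdet N (\<lambda>i j. bethe_col x i (\<xi> j) * g j)
    = (\<Prod>i<N. \<Prod>j\<in>{i<..<N}. \<xi> j / (1 - \<xi> j) - \<xi> i / (1 - \<xi> i)) * (\<Prod>j<N. \<xi> j powi x / (1 - \<xi> j) * g j)"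
proof -
  have "fdet N (\<lambda>i j. bethe_col x i (\<xi> j) * g j)
      = fdet N (\<lambda>i j. (\<xi> j / (1 - \<xi> j)) ^ i * (\<xi> j powi x / (1 - \<xi> j) * g j))"
    using assms by (intro fdet_cong) (simp add: bethe_col_eq)
  also have "\<dots> = fdet N (\<lambda>i j. (\<xi> j / (1 - \<xi> j)) ^ i) * (\<Prod>j<N. \<xi> j powi x / (1 - \<xi> j) * g j)"
    by (rule fdet_scale_cols)
  finally show ?thesis by (simp only: vandermonde)
qed

text \<open>For each pair the two Vandermonde differences multiply to minus
  \<open>(\<xi> j - \<xi> i)\<^sup>2 * (w i * w j)\<close>, which yields the square, the overall
  sign and \<open>w j ^ (N - 1)\<close> for each variable. The extra
  \<open>\<Prod>j<N. \<xi> j\<close> will be matched by the line elements.\<close>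

lemma fdet_bethe_mult:
  assumes \<xi>: "\<And>j. j < N \<Longrightarrow> \<xi> j \<noteq> 0 \<and> \<xi> j \<noteq> 1" and k: "1 \<le> k" and N: "1 \<le> N"
  shows "fdet N (\<lambda>i j. bethe_row k i (int i + 1) (\<xi> j)) *
      fdet N (\<lambda>i j. bethe_col x i (\<xi> j) * exp (eps (\<xi> j) * of_real t))
    = (-1) ^ (N * (N - 1) div 2) * (integrand N x t \<xi> * (\<Prod>j<N. \<xi> j))"
proof -
  define w where "w j = 1 / (\<xi> j * (1 - \<xi> j))" for j
  define g where "g j = exp (eps (\<xi> j) * of_real t)" for j
  let ?v = "\<lambda>j. 1 / \<xi> j - 1" and ?u = "\<lambda>j. \<xi> j / (1 - \<xi> j)"
  have pair: "(?v j - ?v i) * (?u j - ?u i) = - 1 * ((\<xi> j - \<xi> i)\<^sup>2 * (w i * w j))"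
    if "i < N" "j < N" for i j
  proof -
    have "?v j - ?v i = - ((\<xi> j - \<xi> i) / (\<xi> i * \<xi> j))"
      "?u j - ?u i = (\<xi> j - \<xi> i) / ((1 - \<xi> i) * (1 - \<xi> j))"
      using \<xi>[OF that(1)] \<xi>[OF that(2)] by (simp_all add: field_simps)
    then show ?thesis by (simp add: w_def power2_eq_square)
  qed
  have "(\<Prod>i<N. \<Prod>j\<in>{i<..<N}. ?v j - ?v i) * (\<Prod>i<N. \<Prod>j\<in>{i<..<N}. ?u j - ?u i)
      = (\<Prod>i<N. \<Prod>j\<in>{i<..<N}. - 1 * ((\<xi> j - \<xi> i)\<^sup>2 * (w i * w j)))"
    unfolding prod.distrib[symmetric] by (intro prod.cong refl pair) auto
  also have "\<dots> = (-1) ^ (N * (N - 1) div 2) * ((\<Prod>i<N. \<Prod>j\<in>{i<..<N}. (\<xi> j - \<xi> i)\<^sup>2) * (\<Prod>j<N. w j ^ (N - 1)))"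
    by (simp only: prod.distrib[of "\<lambda>_. - 1"] prod.distrib[of "\<lambda>j. (\<xi> j - \<xi> i)\<^sup>2" for i]
        prod.distrib[of "\<lambda>i. \<Prod>j\<in>{i<..<N}. (\<xi> j - \<xi> i)\<^sup>2"] prod.distrib[of "\<lambda>i. \<Prod>j\<in>{i<..<N}. - 1"]
        prod_pairs_const prod_pairs_mult)
  finally have vu: "(\<Prod>i<N. \<Prod>j\<in>{i<..<N}. ?v j - ?v i) * (\<Prod>i<N. \<Prod>j\<in>{i<..<N}. ?u j - ?u i)
      = (-1) ^ (N * (N - 1) div 2) * ((\<Prod>i<N. \<Prod>j\<in>{i<..<N}. (\<xi> j - \<xi> i)\<^sup>2) * (\<Prod>j<N. w j ^ (N - 1)))" .
  have single: "w j ^ (N - 1) * (?v j * (\<xi> j powi x / (1 - \<xi> j) * g j))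
      = (-1) ^ (N - 1) * (1 / (\<xi> j - 1) ^ (N - 1) * (\<xi> j powi (x - int N - 1) * g j * \<xi> j))" if "j < N" for j
  proof -
    have nz: "\<xi> j \<noteq> 0" "1 - \<xi> j \<noteq> 0" using \<xi>[OF that] by auto
    \<comment> \<open>Of the \<open>N + 1\<close> powers split off, \<open>N - 1\<close> cancel
      against \<open>w j ^ (N - 1)\<close>, one against \<open>?v j / (1 - \<xi> j)\<close>, and one
      is kept for the line element.\<close>
    have "\<xi> j powi (x - int N - 1) * \<xi> j * \<xi> j ^ (N - 1) * \<xi> j = \<xi> j powi (x - int N - 1) * \<xi> j powi (int N + 1)"
    proof -
      have "\<xi> j * \<xi> j ^ (N - 1) * \<xi> j = \<xi> j ^ Suc N"
        using N by (cases N) simp_all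
      also have "\<dots> = \<xi> j powi (int N + 1)"
        using power_int_of_nat[of "\<xi> j" "Suc N"] by (simp add: add.commute)
      finally show ?thesis by (simp only: mult.assoc)
    qed
    also have "\<dots> = \<xi> j powi x"
      using nz by (simp flip: power_int_add)
    finally have x: "\<xi> j powi x = \<xi> j powi (x - int N - 1) * \<xi> j * \<xi> j ^ (N - 1) * \<xi> j" ..
    have "(\<xi> j - 1) ^ (N - 1) = (-1) ^ (N - 1) * (1 - \<xi> j) ^ (N - 1)"
      unfolding power_mult_distrib[symmetric] by simp
    then have s: "(-1) ^ (N - 1) * (1 / (\<xi> j - 1) ^ (N - 1)) = 1 / (1 - \<xi> j) ^ (N - 1)"
      by simp
    have v: "?v j * (1 / (1 - \<xi> j)) * \<xi> j = 1" using nz by (simp add: field_simps)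
    have "w j ^ (N - 1) * (?v j * (\<xi> j powi x / (1 - \<xi> j) * g j))
        = 1 / (1 - \<xi> j) ^ (N - 1) * (\<xi> j powi (x - int N - 1) * g j * \<xi> j) * (?v j * (1 / (1 - \<xi> j)) * \<xi> j)"
      unfolding x w_def using nz by (simp add: power_mult_distrib power_divide)
    then show ?thesis unfolding v s[symmetric] by (simp only: mult_ac mult_1_right mult_1_left)
  qed
  \<comment> \<open>\<open>N * (N - 1)\<close> is even, so replacing every
    \<open>1 - \<xi> j\<close> by \<open>\<xi> j - 1\<close> costs no sign.\<close>
  have sgn: "(\<Prod>j<N. (-1) ^ (N - 1)) = (1::complex)"
  proof -
    have "even ((N - 1) * N)" by (cases N) auto
    then show ?thesis by (simp add: power_mult[symmetric])
  qed
  have "(\<Prod>j<N. w j ^ (N - 1)) * ((\<Prod>j<N. ?v j) * (\<Prod>j<N. \<xi> j powi x / (1 - \<xi> j) * g j))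
      = (\<Prod>j<N. (-1) ^ (N - 1) * (1 / (\<xi> j - 1) ^ (N - 1) * (\<xi> j powi (x - int N - 1) * g j * \<xi> j)))"
    unfolding prod.distrib[symmetric] by (intro prod.cong refl single) simp
  also have "\<dots> = (\<Prod>j<N. 1 / (\<xi> j - 1) ^ (N - 1)) * ((\<Prod>j<N. \<xi> j powi (x - int N - 1) * g j) * (\<Prod>j<N. \<xi> j))"
    unfolding prod.distrib sgn mult_1_left ..
  finally have rest: "(\<Prod>j<N. w j ^ (N - 1)) * ((\<Prod>j<N. ?v j) * (\<Prod>j<N. \<xi> j powi x / (1 - \<xi> j) * g j))
      = (\<Prod>j<N. 1 / (\<xi> j - 1) ^ (N - 1)) * ((\<Prod>j<N. \<xi> j powi (x - int N - 1) * g j) * (\<Prod>j<N. \<xi> j))" .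
  have row: "fdet N (\<lambda>i j. bethe_row k i (int i + 1) (\<xi> j))
      = (\<Prod>i<N. \<Prod>j\<in>{i<..<N}. ?v j - ?v i) * (\<Prod>j<N. ?v j)"
    by (rule fdet_bethe_row_step) (use \<xi> k in auto)
  have col: "fdet N (\<lambda>i j. bethe_col x i (\<xi> j) * g j)
      = (\<Prod>i<N. \<Prod>j\<in>{i<..<N}. ?u j - ?u i) * (\<Prod>j<N. \<xi> j powi x / (1 - \<xi> j) * g j)"
    by (rule fdet_bethe_col) (use \<xi> in auto)
  have "fdet N (\<lambda>i j. bethe_row k i (int i + 1) (\<xi> j)) * fdet N (\<lambda>i j. bethe_col x i (\<xi> j) * g j)
      = (\<Prod>i<N. \<Prod>j\<in>{i<..<N}. ?v j - ?v i) * (\<Prod>i<N. \<Prod>j\<in>{i<..<N}. ?u j - ?u i) *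
        ((\<Prod>j<N. ?v j) * (\<Prod>j<N. \<xi> j powi x / (1 - \<xi> j) * g j))"
    unfolding row col by (simp only: mult_ac)
  also have "\<dots> = (-1) ^ (N * (N - 1) div 2) * ((\<Prod>i<N. \<Prod>j\<in>{i<..<N}. (\<xi> j - \<xi> i)\<^sup>2) *
      ((\<Prod>j<N. w j ^ (N - 1)) * ((\<Prod>j<N. ?v j) * (\<Prod>j<N. \<xi> j powi x / (1 - \<xi> j) * g j))))"
    unfolding vu by (simp only: mult_ac)
  also have "\<dots> = (-1) ^ (N * (N - 1) div 2) * (integrand N x t \<xi> * (\<Prod>j<N. \<xi> j))"
    unfolding rest integrand_def g_def[symmetric] by (simp only: mult_ac)
  finally show ?thesis unfolding g_def .
qed

section \<open>Assembling the contour integral\<close>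

context small_circle
begin

lemma tasep_prob_step_init:
  assumes N: "1 \<le> N" and k: "1 \<le> k" "k \<le> N"
  shows "complex_of_real (tasep_prob t (step_init N, nu N k) (E_event N k x)) =
    (-1) ^ (N * (N - 1) div 2) / of_nat (fact N) / (2 * pi * \<i>) ^ N
      * circle_integral_N N r (integrand N x t)"
proof -
  let ?M = "PiM {..<N} (\<lambda>_. circle_measure)"
  define g where "g \<xi> = exp (eps \<xi> * of_real t)" for \<xi>
  define a where "a i \<theta> = bethe_row k i (int i + 1) (pt \<theta>)" for i \<theta>
  define b where "b j \<theta> = bethe_col x j (pt \<theta>) * g (pt \<theta>)" for j \<theta>
  have nth: "step_init N ! i = int i + 1" if "i < N" for i
    using that by (simp add: step_init_def nth_append del: upt_Suc)
  have "continuous_on (sphere 0 r) g"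
    unfolding g_def[abs_def] eps_def by (intro continuous_intros ballI sphere_neq)
  then have int: "integrable circle_measure (\<lambda>\<theta>. a i \<theta> * b j \<theta>)" for i j
    unfolding a_def b_def
    by (intro circle.integrable_bdd_measurable bdd_measurable_mult bdd_measurable_circle
        continuous_bethe_row continuous_bethe_col r)
  have sf: "sigma_finite_measure circle_measure" by unfold_locales
  \<comment> \<open>The Poisson normalisation contributes one \<open>- 1\<close> per variable,
    turning \<open>1 / \<xi>\<close> into \<open>eps \<xi>\<close>.\<close>
  have g_prod: "exp (of_real t * (\<Sum>j<N. 1 / pt (\<theta> j)) - of_real t * of_nat N) = (\<Prod>j<N. g (pt (\<theta> j)))" for \<theta>
  proof -
    have "of_real t * (\<Sum>j<N. 1 / pt (\<theta> j)) - of_real t * of_nat N = (\<Sum>j<N. eps (pt (\<theta> j)) * of_real t)"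
      unfolding eps_def sum_distrib_right[symmetric] sum_subtractf by (simp add: algebra_simps)
    then show ?thesis by (simp add: g_def exp_sum)
  qed
  have "complex_of_real (tasep_prob t (step_init N, nu N k) (E_event N k x)) = 1 / (2 * of_real pi) ^ N *
    (\<integral>\<theta>. exp (of_real t * (\<Sum>j<N. 1 / pt (\<theta> j)) - of_real t * of_nat N) *
      (fdet N (\<lambda>i j. bethe_row k i (step_init N ! i) (pt (\<theta> j))) * (\<Prod>j<N. bethe_col x j (pt (\<theta> j)))) \<partial>?M)"
    by (rule tasep_prob_eq[OF k]) (simp_all add: nth, simp add: step_init_def)
  also have "(\<lambda>\<theta>. exp (of_real t * (\<Sum>j<N. 1 / pt (\<theta> j)) - of_real t * of_nat N) *
      (fdet N (\<lambda>i j. bethe_row k i (step_init N ! i) (pt (\<theta> j))) * (\<Prod>j<N. bethe_col x j (pt (\<theta> j)))))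
      = (\<lambda>\<theta>. fdet N (\<lambda>i j. a i (\<theta> j)) * (\<Prod>j<N. b j (\<theta> j)))"
  proof
    fix \<theta> :: "nat \<Rightarrow> real"
    have "fdet N (\<lambda>i j. bethe_row k i (step_init N ! i) (pt (\<theta> j))) = fdet N (\<lambda>i j. a i (\<theta> j))"
      by (intro fdet_cong) (simp add: a_def nth)
    then show "exp (of_real t * (\<Sum>j<N. 1 / pt (\<theta> j)) - of_real t * of_nat N) *
        (fdet N (\<lambda>i j. bethe_row k i (step_init N ! i) (pt (\<theta> j))) * (\<Prod>j<N. bethe_col x j (pt (\<theta> j))))
        = fdet N (\<lambda>i j. a i (\<theta> j)) * (\<Prod>j<N. b j (\<theta> j))"
      unfolding g_prod b_def prod.distrib by (simp only: mult_ac)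
  qed
  \<comment> \<open>Andreief's identity read backwards: the product of the \<open>b j\<close>
    becomes their determinant at the cost of \<open>1 / fact N\<close>.\<close>
  also have "(\<integral>\<theta>. fdet N (\<lambda>i j. a i (\<theta> j)) * (\<Prod>j<N. b j (\<theta> j)) \<partial>?M)
      = 1 / fact N * (\<integral>\<theta>. fdet N (\<lambda>i j. a i (\<theta> j)) * fdet N (\<lambda>i j. b i (\<theta> j)) \<partial>?M)"
    using andreief[OF sf int, of N] integral_fdet_prod[OF sf int, of N] by simp
  also have "(\<lambda>\<theta>. fdet N (\<lambda>i j. a i (\<theta> j)) * fdet N (\<lambda>i j. b i (\<theta> j)))
      = (\<lambda>\<theta>. (-1) ^ (N * (N - 1) div 2) / \<i> ^ N *
        (integrand N x t (\<lambda>j. pt (\<theta> j)) * (\<Prod>j<N. \<i> * of_real r * cis (\<theta> j))))"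
  proof
    fix \<theta> :: "nat \<Rightarrow> real"
    \<comment> \<open>Each line element carries a factor \<open>\<i>\<close>; the compensating
      \<open>1 / \<i> ^ N\<close> later completes \<open>(2 * pi * \<i>) ^ N\<close>.\<close>
    have "(\<Prod>j<N. \<i> * of_real r * cis (\<theta> j)) = \<i> ^ N * (\<Prod>j<N. pt (\<theta> j))"
      by (simp add: prod.distrib mult.assoc)
    then show "fdet N (\<lambda>i j. a i (\<theta> j)) * fdet N (\<lambda>i j. b i (\<theta> j)) = (-1) ^ (N * (N - 1) div 2) / \<i> ^ N *
        (integrand N x t (\<lambda>j. pt (\<theta> j)) * (\<Prod>j<N. \<i> * of_real r * cis (\<theta> j)))"
      using fdet_bethe_mult[of N "\<lambda>j. pt (\<theta> j)" k x t] pt_nonzero pt_neq_1 k(1) N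
      by (simp add: a_def b_def g_def)
  qed
  also have "(\<integral>\<theta>. (-1) ^ (N * (N - 1) div 2) / \<i> ^ N *
      (integrand N x t (\<lambda>j. pt (\<theta> j)) * (\<Prod>j<N. \<i> * of_real r * cis (\<theta> j))) \<partial>?M)
      = (-1) ^ (N * (N - 1) div 2) / \<i> ^ N * circle_integral_N N r (integrand N x t)"
    unfolding circle_integral_N_def by (rule integral_mult_right_zero)
  finally show ?thesis by (simp add: power_mult_distrib)
qed

end

theorem theorem1p2:
  fixes N k :: nat and x :: int and t r :: real
  assumes "1 \<le> N" and "1 \<le> k" and "k \<le> N" and "0 \<le> t" and "0 < r" and "r < 1"
  shows "complex_of_real (tasep_prob t (step_init N, nu N k) (E_event N k x)) =
    (-1) ^ (N * (N - 1) div 2) / of_nat (fact N) / (2 * pi * \<i>) ^ N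
      * circle_integral_N N r (integrand N x t)"
proof -
  interpret small_circle r
    using assms by unfold_locales
  show ?thesis
    using assms by (intro tasep_prob_step_init)
qed

end
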